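(* Let $d\ge1$, let $T\subset\mathbb R^d$ be a mesh element (an open, bounded, connected, Lipschitz polytope), $\mathbf x_T\in T$, and $p\in\mathbb N$. Let $\mathcal Lv=\mathrm{div}(-\boldsymbol K\nabla v+\boldsymbol\beta v)+\sigma v$ with $\boldsymbol K_{jm},\boldsymbol\beta_j\in C^{\max\{p-1,1\}}(T)$ for all $j,m=1,\dots,d$, $\sigma\in C^{\max\{p-2,0\}}(T)$, and suppose there is $k_{min}>0$ such that $\boldsymbol\xi^T\boldsymbol K(\mathbf x)\boldsymbol\xi\ge k_{min}|\boldsymbol\xi|^2$ for all $\boldsymbol\xi\in\mathbb R^d$ and $\mathbf x\in T$. Then the set $\mathcal B^p_T$ (defined in the context) constitutes a basis for the space $\mathbb{QT}^p(T)$.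
   Context: $\mathbb N=\{0,1,2,\dots\}$. $\mathbb P^p_d(T)$ is the space of polynomials of total degree at most $p$ in $d$ variables on $T$; $\mathbb P^p(\mathbb R^{n})$ is the space of polynomials of total degree at most $p$ in $n$ variables, of dimension $S_{n,p}=\binom{p+n}{n}$ (for $n=0$ these are constants; $\mathbb P^{-1}=\{0\}$, with $S_{n,-1}=0$). The local quasi-Trefftz space is $$\mathbb{QT}^p(T)=\{v\in\mathbb P^p_d(T)\mid D^{\boldsymbol i}(\mathcal Lv)(\mathbf x_T)=0\ \ \forall\boldsymbol i\in\mathbb N^d,\ |\boldsymbol i|\le p-2\}.$$ Fix a basis $\{\widehat f_s\}_{s=1,\dots,S_{d-1,p}}$ of $\mathbb P^p(\mathbb R^{d-1})$ and a basis $\{\widetilde f_s\}_{s=1,\dots,S_{d-1,p-1}}$ of $\mathbb P^{p-1}(\mathbb R^{d-1})$, and let $N_{d,p}=S_{d-1,p}+S_{d-1,p-1}$. The set $\mathcal B^p_T=\{b_J\}_{J=1,\dots,N_{d,p}}$ consists of the elements $b_J\in\mathbb{QT}^p(T)$ such that $$b_J((\mathbf x_T)_1,\cdot)=\widehat f_J\ \text{ and }\ \partial_{x_1}b_J((\mathbf x_T)_1,\cdot)=0\qquad\text{for } J\le S_{d-1,p},$$ $$b_J((\mathbf x_T)_1,\cdot)=0\ \text{ and }\ \partial_{x_1}b_J((\mathbf x_T)_1,\cdot)=\widetilde f_{J-S_{d-1,p}}\qquad\text{for } J\ge S_{d-1,p}+1.$$ Here $b((\mathbf x_T)_1,\cdot)$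 denotes the restriction of the polynomial $b$ to the hyperplane $\{x_1=(\mathbf x_T)_1\}$, viewed as a polynomial in $(x_2,\dots,x_d)$. *)

theory Defs
  imports "HOL-Analysis.Analysis" "HOL-Library.Function_Algebras"
begin

instantiation "fun" :: (type, real_vector) real_vector
begin

definition scaleR_fun :: "real \<Rightarrow> ('a \<Rightarrow> 'b) \<Rightarrow> 'a \<Rightarrow> 'b"
  where "scaleR_fun c f = (\<lambda>x. c *\<^sub>R f x)"

instance
  by standard (auto simp: scaleR_fun_def fun_eq_iff scaleR_add_right scaleR_add_left)

end

definition is_basis :: "'v::real_vector set \<Rightarrow> 'v set \<Rightarrow> bool"
  where "is_basis B V \<longleftrightarrow> independent B \<and> span B = V"

definition is_basis_family :: "'i set \<Rightarrow> ('i \<Rightarrow> 'v::real_vector) \<Rightarrow> 'v set \<Rightarrow> bool"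
  where "is_basis_family I f V \<longleftrightarrow> inj_on f I \<and> is_basis (f ` I) V"


(* Points of R^d have type real^'d, where the finite index type 'd is linearly ordered: d = CARD('d)
   is at least 1, and first_coord is the index of the coordinate x_1. *)

type_synonym 'd point = "(real, 'd) vec"
type_synonym 'd scalar_field = "(real, 'd) vec \<Rightarrow> real"
type_synonym 'd vector_field = "(real, 'd) vec \<Rightarrow> (real, 'd) vec"
type_synonym 'd matrix_field = "(real, 'd) vec \<Rightarrow> ((real, 'd) vec, 'd) vec"
type_synonym 'd multi_index = "(nat, 'd) vec"

definition first_coord :: "'d::{finite,linorder}"
  where "first_coord = Min UNIV"

definition partial :: "'d::finite \<Rightarrow> (real^'d \<Rightarrow> real) \<Rightarrow> real^'d \<Rightarrow> real"
  where "partial j f x = deriv (\<lambda>t. f (x + t *\<^sub>R axis j 1)) 0"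

primrec Ck_on :: "nat \<Rightarrow> (real^'d::finite) set \<Rightarrow> (real^'d \<Rightarrow> real) \<Rightarrow> bool"
  where
    "Ck_on 0 T f \<longleftrightarrow> continuous_on T f"
  | "Ck_on (Suc k) T f \<longleftrightarrow> continuous_on T f \<and>
       (\<forall>j. (\<forall>x\<in>T. (\<lambda>t. f (x + t *\<^sub>R axis j 1)) differentiable at 0) \<and> Ck_on k T (partial j f))"

definition mi_abs :: "nat^'d::finite \<Rightarrow> nat"
  where "mi_abs i = (\<Sum>j\<in>UNIV. i $ j)"

(* D^i = \<partial>_1^(i_1) ... \<partial>_d^(i_d) *)
definition mi_deriv :: "'d::{finite,linorder} multi_index \<Rightarrow> 'd scalar_field \<Rightarrow> 'd scalar_field"
  where "mi_deriv i f = foldr (\<lambda>j g. (partial j ^^ (i $ j)) g) (sorted_list_of_set UNIV) f"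

definition gradient :: "(real^'d::finite \<Rightarrow> real) \<Rightarrow> real^'d \<Rightarrow> real^'d"
  where "gradient v x = (\<chi> j. partial j v x)"

definition divergence :: "(real^'d::finite \<Rightarrow> real^'d) \<Rightarrow> real^'d \<Rightarrow> real"
  where "divergence F x = (\<Sum>j\<in>UNIV. partial j (\<lambda>y. F y $ j) x)"

definition diff_op :: "(real^'d::finite \<Rightarrow> real^'d^'d) \<Rightarrow> (real^'d \<Rightarrow> real^'d) \<Rightarrow> (real^'d \<Rightarrow> real) \<Rightarrow>
    (real^'d \<Rightarrow> real) \<Rightarrow> real^'d \<Rightarrow> real"
  where "diff_op K \<beta> \<sigma> v x =
    divergence (\<lambda>y. - (K y *v gradient v y) + v y *\<^sub>R \<beta> y) x + \<sigma> x * v x"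


(* Polynomials in the variables (x_j), j in I, of total degree at most p, as functions on the
   whole of R^d that depend on these coordinates only.  For I = UNIV this is P^p_d (a polynomial
   on a nonempty open T is identified with its extension to R^d); for I = UNIV - {first_coord} it
   is P^p(R^(d-1)), which consists of the constants if d = 1.  For p = -1 it is {0}. *)
definition poly_space :: "'d::finite set \<Rightarrow> int \<Rightarrow> (real^'d \<Rightarrow> real) set"
  where "poly_space I p =
    span {(\<lambda>x. \<Prod>j\<in>I. (x $ j) ^ (\<alpha> $ j)) | \<alpha>::nat^'d. int (\<Sum>j\<in>I. \<alpha> $ j) \<le> p}"

definition poly_dim :: "nat \<Rightarrow> int \<Rightarrow> nat"
  where "poly_dim n p = (if p < 0 then 0 else (nat p + n) choose n)"

definition quasi_trefftz :: "'d::{finite,linorder} matrix_field \<Rightarrow> 'd vector_field \<Rightarrow>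
    'd scalar_field \<Rightarrow> 'd point \<Rightarrow> nat \<Rightarrow> 'd scalar_field set"
  where "quasi_trefftz K \<beta> \<sigma> xT p =
    {v \<in> poly_space UNIV (int p).
      \<forall>i. int (mi_abs i) \<le> int p - 2 \<longrightarrow> mi_deriv i (diff_op K \<beta> \<sigma> v) xT = 0}"

(* b(c, .) : restriction to the hyperplane x_1 = c, as a function of (x_2, ..., x_d) *)
definition restrict_first :: "real \<Rightarrow> 'd::{finite,linorder} scalar_field \<Rightarrow> 'd scalar_field"
  where "restrict_first c b = (\<lambda>x. b (\<chi> j. if j = first_coord then c else x $ j))"

definition qt_basis_element :: "'d::{finite,linorder} matrix_field \<Rightarrow> 'd vector_field \<Rightarrow>
    'd scalar_field \<Rightarrow> 'd point \<Rightarrow> nat \<Rightarrow> (nat \<Rightarrow> 'd scalar_field) \<Rightarrow> (nat \<Rightarrow> 'd scalar_field) \<Rightarrow>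
    nat \<Rightarrow> 'd scalar_field \<Rightarrow> bool"
  where "qt_basis_element K \<beta> \<sigma> xT p fhat ftilde J b \<longleftrightarrow>
    b \<in> quasi_trefftz K \<beta> \<sigma> xT p \<and>
    (let S = poly_dim (CARD('d) - 1) (int p);
         c = xT $ first_coord
     in if J \<le> S
        then restrict_first c b = fhat J \<and> restrict_first c (partial first_coord b) = 0
        else restrict_first c b = 0 \<and> restrict_first c (partial first_coord b) = ftilde (J - S))"

definition qt_basis_card :: "nat \<Rightarrow> nat \<Rightarrow> nat"
  where "qt_basis_card d p = poly_dim (d - 1) (int p) + poly_dim (d - 1) (int p - 1)"

definition qt_basis :: "'d::{finite,linorder} matrix_field \<Rightarrow> 'd vector_field \<Rightarrow>
    'd scalar_field \<Rightarrow> 'd point \<Rightarrow> nat \<Rightarrow> (nat \<Rightarrow> 'd scalar_field) \<Rightarrow> (nat \<Rightarrow> 'd scalar_field) \<Rightarrow>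
    'd scalar_field set"
  where "qt_basis K \<beta> \<sigma> xT p fhat ftilde =
    {b. \<exists>J\<in>{1..qt_basis_card CARD('d) p}. qt_basis_element K \<beta> \<sigma> xT p fhat ftilde J b}"


(* Near each boundary point T is the strict epigraph, in some direction e, of a Lipschitz
   function on the hyperplane orthogonal to e. *)
definition lipschitz_boundary :: "'a::euclidean_space set \<Rightarrow> bool"
  where "lipschitz_boundary T \<longleftrightarrow>
    (\<forall>x\<in>frontier T. \<exists>U e g L. open U \<and> x \<in> U \<and> norm e = 1 \<and>
       L-lipschitz_on {y. y \<bullet> e = 0} g \<and>
       T \<inter> U = {y \<in> U. g (y - (y \<bullet> e) *\<^sub>R e) < y \<bullet> e})"

(* The library's polytopes are convex; mesh elements need not be. *)
definition mesh_element :: "'a::euclidean_space set \<Rightarrow> bool"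
  where "mesh_element T \<longleftrightarrow> open T \<and> bounded T \<and> connected T \<and> lipschitz_boundary T \<and>
    (\<exists>F. finite F \<and> (\<forall>P\<in>F. polytope P) \<and> closure T = \<Union>F)"

end

theory Submission
  imports Defs
begin

text \<open>
  Write \<open>v = (\<Sum>\<alpha>. a \<alpha> * (x - x_T)^\<alpha>)\<close>. At \<open>x_T\<close> the condition of index \<open>i\<close> annihilates the
  monomials of degree greater than \<open>|i| + 2\<close>. Those of degree \<open>|i| + 2\<close> enter only through the
  principal part, so the one with the largest exponent of \<open>x_1\<close> is \<open>\<alpha> = i + 2 e_1\<close>, with
  coefficient \<open>- K_11(x_T) \<alpha>! \<noteq> 0\<close> by ellipticity. The conditions are therefore a triangular system
  for the coefficients with \<open>\<alpha>_1 \<ge> 2\<close>, and the remaining coefficients, which are the data of \<open>v\<close> and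
  \<open>\<partial>_1 v\<close> on the hyperplane, can be prescribed freely. Hence restriction to the data is a linear
  isomorphism, and the \<open>b_J\<close> are the preimages of a basis.
\<close>

subsection \<open>Linear algebra\<close>

text \<open>The coefficients of the operator have finite smoothness, so
  \<open>diff_op K \<beta> \<sigma> v\<close> need not be a polynomial, and its derivatives at the
  centre involve derivatives of the coefficients. None of these is ever computed: they enter only
  through monomials of degree below |i| + 2, and such entries of the system may be arbitrary,
  because elimination proceeds by degree before it looks at the exponent of x_1. The condition K_11
  \<noteq> 0 says that the hyperplane through x_T orthogonal to e_1 is noncharacteristic there, so
  the argument is a Cauchy-Kovalevskaya recursion cut off at degree p. Derivatives are iterated
  along a list of directions in a fixed order, so the symmetry of mixed derivatives of the
  coefficients never comes up. Partial differentiation is linear only on differentiable functions,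
  which is why linearity is always asked for on a subspace.\<close>

lemma is_basis_family_iff:
  assumes "finite I"
  shows "is_basis_family I f V \<longleftrightarrow>
    (\<forall>c. (\<Sum>i\<in>I. c i *\<^sub>R f i) = 0 \<longrightarrow> (\<forall>i\<in>I. c i = 0)) \<and>
    V = range (\<lambda>c. \<Sum>i\<in>I. c i *\<^sub>R f i)" (is "_ \<longleftrightarrow> ?ind \<and> V = ?R")
proof -
  have reindex: "(\<Sum>v\<in>f ` I. u v *\<^sub>R v) = (\<Sum>i\<in>I. u (f i) *\<^sub>R f i)" if "inj_on f I" for u
    using that by (simp add: sum.reindex)
  have span: "span (f ` I) = ?R" if inj: "inj_on f I"
  proof -
    have "(\<Sum>i\<in>I. c i *\<^sub>R f i) = (\<Sum>v\<in>f ` I. c (the_inv_into I f v) *\<^sub>R v)" for c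
      using inj by (auto simp: reindex the_inv_into_f_f intro!: sum.cong)
    then have "range (\<lambda>c. \<Sum>i\<in>I. c i *\<^sub>R f i) \<subseteq> range (\<lambda>u. \<Sum>v\<in>f ` I. u v *\<^sub>R v)"
      by auto
    moreover have "range (\<lambda>u. \<Sum>v\<in>f ` I. u v *\<^sub>R v) \<subseteq> range (\<lambda>c. \<Sum>i\<in>I. c i *\<^sub>R f i)"
      using reindex[OF inj] by auto
    ultimately show ?thesis
      using assms by (simp add: span_finite)
  qed
  have inj: "inj_on f I" if ?ind
  proof (rule inj_onI, rule ccontr)
    fix i j assume ij: "i \<in> I" "j \<in> I" "f i = f j" "i \<noteq> j"
    \<comment> \<open>Two equal members give the relation f i - f j = 0, so injectivity already
      follows from independence of the coefficients.\<close>
    define c where "c = (\<lambda>k. if k = i then 1 else if k = j then -1 else (0::real))"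
    have "(\<Sum>k\<in>I. c k *\<^sub>R f k) = (\<Sum>k\<in>{i, j}. c k *\<^sub>R f k)"
      using assms ij by (intro sum.mono_neutral_right) (auto simp: c_def)
    also have "\<dots> = 0" using ij by (simp add: c_def)
    finally have "c i = 0" using \<open>?ind\<close> ij by blast
    then show False by (simp add: c_def)
  qed
  have ind: "independent (f ` I) \<longleftrightarrow> ?ind" if inj: "inj_on f I"
  proof
    assume indep: "independent (f ` I)"
    show ?ind
    proof (intro allI impI ballI)
      fix c i assume 0: "(\<Sum>i\<in>I. c i *\<^sub>R f i) = 0" and i: "i \<in> I"
      have "(\<Sum>v\<in>f ` I. c (the_inv_into I f v) *\<^sub>R v) = (\<Sum>i\<in>I. c i *\<^sub>R f i)"
        using inj by (auto simp: reindex the_inv_into_f_f intro!: sum.cong)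
      with 0 have "c (the_inv_into I f (f i)) = 0"
        using independentD[OF indep, of "f ` I" "\<lambda>v. c (the_inv_into I f v)" "f i"] assms i by simp
      then show "c i = 0" using inj i by (simp add: the_inv_into_f_f)
    qed
  next
    assume ?ind
    show "independent (f ` I)"
    proof
      assume "dependent (f ` I)"
      then obtain u where "\<exists>v\<in>f ` I. u v \<noteq> 0" "(\<Sum>v\<in>f ` I. u v *\<^sub>R v) = 0"
        using assms by (auto simp: dependent_finite)
      then show False
        using \<open>?ind\<close> reindex[OF inj, of u] by auto
    qed
  qed
  show ?thesis
    using span inj ind unfolding is_basis_family_def is_basis_def by blast
qed

lemma is_basis_family_in_space: "is_basis_family I f V \<Longrightarrow> i \<in> I \<Longrightarrow> f i \<in> V"
  by (auto simp: is_basis_family_def is_basis_def intro: span_base)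

text \<open>The map v -> (\<phi> v, \<psi> v) embeds Q linearly into F x G, and the families
  \<open>b\<close> and \<open>b'\<close> are sent to the canonical basis of the product. Linearity
  is required on Q alone, since \<psi> will contain a partial derivative.\<close>

lemma is_basis_preimages:
  fixes \<phi> \<psi> :: "'v::real_vector \<Rightarrow> 'w::real_vector"
  assumes fin: "finite I" "finite J"
    and f: "is_basis_family I f F" and g: "is_basis_family J g G"
    and Q: "subspace Q"
    and add: "\<And>v w. v \<in> Q \<Longrightarrow> w \<in> Q \<Longrightarrow> \<phi> (v + w) = \<phi> v + \<phi> w"
      "\<And>v w. v \<in> Q \<Longrightarrow> w \<in> Q \<Longrightarrow> \<psi> (v + w) = \<psi> v + \<psi> w"
    and scale: "\<And>c v. v \<in> Q \<Longrightarrow> \<phi> (c *\<^sub>R v) = c *\<^sub>R \<phi> v" "\<And>c v. v \<in> Q \<Longrightarrow> \<psi> (c *\<^sub>R v) = c *\<^sub>R \<psi> v"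
    and image: "\<And>v. v \<in> Q \<Longrightarrow> \<phi> v \<in> F" "\<And>v. v \<in> Q \<Longrightarrow> \<psi> v \<in> G"
    and kernel: "\<And>v. v \<in> Q \<Longrightarrow> \<phi> v = 0 \<Longrightarrow> \<psi> v = 0 \<Longrightarrow> v = 0"
    and b: "\<And>i. i \<in> I \<Longrightarrow> b i \<in> Q \<and> \<phi> (b i) = f i \<and> \<psi> (b i) = 0"
    and b': "\<And>j. j \<in> J \<Longrightarrow> b' j \<in> Q \<and> \<phi> (b' j) = 0 \<and> \<psi> (b' j) = g j"
  shows "is_basis (b ` I \<union> b' ` J) Q"
proof -
  have zero: "\<phi> 0 = 0" "\<psi> 0 = 0"
    using scale[of 0 0] subspace_0[OF Q] by auto
  have lin: "(\<Sum>k\<in>A. c k *\<^sub>R u k) \<in> Q \<and> \<phi> (\<Sum>k\<in>A. c k *\<^sub>R u k) = (\<Sum>k\<in>A. c k *\<^sub>R \<phi> (u k)) \<and>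
      \<psi> (\<Sum>k\<in>A. c k *\<^sub>R u k) = (\<Sum>k\<in>A. c k *\<^sub>R \<psi> (u k))"
    if "finite A" "\<And>k. k \<in> A \<Longrightarrow> u k \<in> Q" for A :: "'k set" and c u
    using that
    by (induction A rule: finite_induct)
      (auto simp: zero add scale Q subspace_0 subspace_add subspace_scale)
  have comb: "(\<Sum>i\<in>I. c i *\<^sub>R b i) + (\<Sum>j\<in>J. d j *\<^sub>R b' j) \<in> Q"
      "\<phi> ((\<Sum>i\<in>I. c i *\<^sub>R b i) + (\<Sum>j\<in>J. d j *\<^sub>R b' j)) = (\<Sum>i\<in>I. c i *\<^sub>R f i)"
      "\<psi> ((\<Sum>i\<in>I. c i *\<^sub>R b i) + (\<Sum>j\<in>J. d j *\<^sub>R b' j)) = (\<Sum>j\<in>J. d j *\<^sub>R g j)" for c d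
    using lin[OF fin(1), of b c] lin[OF fin(2), of b' d] b b' by (auto simp: add Q subspace_add)
  \<comment> \<open>The disjoint sum of the index sets turns the two families into one, so that
    injectivity across the two is covered as well.\<close>
  let ?h = "case_sum b b'"
  have sum_h: "(\<Sum>k\<in>I <+> J. c k *\<^sub>R ?h k) =
      (\<Sum>i\<in>I. c (Inl i) *\<^sub>R b i) + (\<Sum>j\<in>J. c (Inr j) *\<^sub>R b' j)" for c
    using fin by (simp add: sum.Plus)
  have "is_basis_family (I <+> J) ?h Q"
  proof (subst is_basis_family_iff, goal_cases)
    case 1
    show ?case using fin by simp
  next
    case 2
    have "\<forall>k\<in>I <+> J. c k = 0" if 0: "(\<Sum>k\<in>I <+> J. c k *\<^sub>R ?h k) = 0" for c
    proof -
      have "(\<Sum>i\<in>I. c (Inl i) *\<^sub>R f i) = 0" "(\<Sum>j\<in>J. c (Inr j) *\<^sub>R g j) = 0"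
        using comb(2,3)[of "\<lambda>i. c (Inl i)" "\<lambda>j. c (Inr j)"] 0 zero by (simp_all add: sum_h)
      then show ?thesis
        using f[unfolded is_basis_family_iff[OF fin(1)], THEN conjunct1, rule_format, of "\<lambda>i. c (Inl i)"]
          g[unfolded is_basis_family_iff[OF fin(2)], THEN conjunct1, rule_format, of "\<lambda>j. c (Inr j)"]
        by auto
    qed
    moreover have "v \<in> range (\<lambda>c. \<Sum>k\<in>I <+> J. c k *\<^sub>R ?h k)" if v: "v \<in> Q" for v
    proof -
      obtain c where c: "\<phi> v = (\<Sum>i\<in>I. c i *\<^sub>R f i)"
        using image(1)[OF v] f fin by (auto simp: is_basis_family_iff)
      obtain d where d: "\<psi> v = (\<Sum>j\<in>J. d j *\<^sub>R g j)"
        using image(2)[OF v] g fin by (auto simp: is_basis_family_iff)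
      define w where "w = (\<Sum>i\<in>I. c i *\<^sub>R b i) + (\<Sum>j\<in>J. d j *\<^sub>R b' j)"
      have w: "w \<in> Q" "\<phi> w = \<phi> v" "\<psi> w = \<psi> v"
        using comb[of c d] c d unfolding w_def by auto
      \<comment> \<open>Additivity is available for sums of elements of Q only, so the difference is
        formed as v + (-1) w.\<close>
      have neg: "- w \<in> Q" "\<phi> (- w) = - \<phi> w" "\<psi> (- w) = - \<psi> w"
        using scale[of w "-1"] w(1) Q by (simp_all add: subspace_neg)
      have "v + (- w) = 0"
        using v w neg Q by (intro kernel) (simp_all add: subspace_add add del: add_uminus_conv_diff)
      then have "v = w" by simp
      then have "v = (\<Sum>k\<in>I <+> J. case_sum c d k *\<^sub>R ?h k)"
        by (simp add: sum_h w_def)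
      then show "v \<in> range (\<lambda>c. \<Sum>k\<in>I <+> J. c k *\<^sub>R ?h k)" by blast
    qed
    moreover have "(\<Sum>k\<in>I <+> J. c k *\<^sub>R ?h k) \<in> Q" for c
      using comb(1) by (simp add: sum_h)
    ultimately show ?case by auto
  qed
  moreover have "?h ` (I <+> J) = b ` I \<union> b' ` J"
    by (simp add: Plus_def image_Un image_image)
  ultimately show ?thesis by (simp add: is_basis_family_def)
qed

text \<open>Elimination by increasing rank: apart from its own unknown, an equation involves only
  unknowns of strictly smaller rank. Hence unknowns of equal rank do not interfere, and fixing those
  of rank n leaves the equations of smaller rank intact. The unknowns outside \<open>B\<close> keep
  the values \<open>a0\<close>.\<close>

lemma triangular_solvable:
  fixes L :: "'i \<Rightarrow> 'i \<Rightarrow> real" and r :: "'i \<Rightarrow> nat"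
  assumes "finite A" "B \<subseteq> A"
    and diag: "\<And>i. i \<in> B \<Longrightarrow> L i i \<noteq> 0"
    and tri: "\<And>i j. i \<in> B \<Longrightarrow> j \<in> A \<Longrightarrow> j \<noteq> i \<Longrightarrow> L i j \<noteq> 0 \<Longrightarrow> r j < r i"
  shows "\<exists>a. (\<forall>i. i \<notin> B \<longrightarrow> a i = a0 i) \<and> (\<forall>i\<in>B. (\<Sum>j\<in>A. a j * L i j) = 0)"
proof -
  have "\<exists>a. (\<forall>i. i \<notin> B \<longrightarrow> a i = a0 i) \<and> (\<forall>i\<in>B. r i < n \<longrightarrow> (\<Sum>j\<in>A. a j * L i j) = 0)" for n
  proof (induction n)
    case 0
    then show ?case by auto
  next
    case (Suc n)
    then obtain a where a: "\<And>i. i \<notin> B \<Longrightarrow> a i = a0 i"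
      and eq: "\<And>i. i \<in> B \<Longrightarrow> r i < n \<Longrightarrow> (\<Sum>j\<in>A. a j * L i j) = 0" by blast
    \<comment> \<open>Each equation of rank n is solved for its diagonal unknown; the sum may use
      the old \<open>a\<close>, whose entries of smaller rank are final.\<close>
    define a' where "a' = (\<lambda>i. if i \<in> B \<and> r i = n
      then - (\<Sum>j\<in>A - {i}. a j * L i j) / L i i else a i)"
    have "(\<Sum>j\<in>A. a' j * L i j) = 0" if i: "i \<in> B" "r i < Suc n" for i
    proof -
      have iA: "i \<in> A" using i assms by auto
      have off: "(\<Sum>j\<in>A - {i}. a' j * L i j) = (\<Sum>j\<in>A - {i}. a j * L i j)"
        using i tri by (intro sum.cong) (force simp: a'_def)+
      have "(\<Sum>j\<in>A. a' j * L i j) = a' i * L i i + (\<Sum>j\<in>A - {i}. a j * L i j)"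
        using assms iA by (simp add: sum.remove off)
      also have "\<dots> = 0"
      proof (cases "r i = n")
        case True
        then show ?thesis using i diag by (simp add: a'_def)
      next
        case False
        then have "a' i * L i i + (\<Sum>j\<in>A - {i}. a j * L i j) = (\<Sum>j\<in>A. a j * L i j)"
          using assms iA by (simp add: sum.remove a'_def)
        then show ?thesis using eq i False by simp
      qed
      finally show ?thesis .
    qed
    then show ?case using a by (intro exI[of _ a']) (auto simp: a'_def)
  qed
  from this[of "Suc (Max (r ` A))"] obtain a where a: "\<forall>i. i \<notin> B \<longrightarrow> a i = a0 i"
    "\<forall>i\<in>B. r i < Suc (Max (r ` A)) \<longrightarrow> (\<Sum>j\<in>A. a j * L i j) = 0" by blast
  have "r i < Suc (Max (r ` A))" if "i \<in> B" for i
    using assms that by (auto simp: less_Suc_eq_le)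
  with a show ?thesis by blast
qed

text \<open>By strong induction on the rank, every off-diagonal term of equation i has a zero entry
  or an unknown already known to vanish.\<close>

lemma triangular_unique:
  fixes L :: "'i \<Rightarrow> 'i \<Rightarrow> real" and r :: "'i \<Rightarrow> nat"
  assumes "finite A" "B \<subseteq> A"
    and diag: "\<And>i. i \<in> B \<Longrightarrow> L i i \<noteq> 0"
    and tri: "\<And>i j. i \<in> B \<Longrightarrow> j \<in> A \<Longrightarrow> j \<noteq> i \<Longrightarrow> L i j \<noteq> 0 \<Longrightarrow> r j < r i"
    and free: "\<And>i. i \<in> A - B \<Longrightarrow> a i = 0"
    and eq: "\<And>i. i \<in> B \<Longrightarrow> (\<Sum>j\<in>A. a j * L i j) = 0"
  shows "i \<in> A \<Longrightarrow> a i = 0"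
proof (induction "r i" arbitrary: i rule: less_induct)
  case less
  show ?case
  proof (cases "i \<in> B")
    case True
    have "(\<Sum>j\<in>A - {i}. a j * L i j) = 0"
      using less tri True by (intro sum.neutral) force
    then have "a i * L i i = 0"
      using eq[OF True] assms(1) less.prems by (simp add: sum.remove)
    then show ?thesis using diag True by simp
  qed (use less free in auto)
qed

subsection \<open>Partial derivatives and centred monomials\<close>

lemma partial_eqI:
  "((\<lambda>t. f (x + t *\<^sub>R axis j 1)) has_real_derivative D) (at 0) \<Longrightarrow> partial j f x = D"
  unfolding partial_def by (rule DERIV_imp_deriv)

lemma has_derivative_partial:
  "(\<lambda>t. f (x + t *\<^sub>R axis j 1)) differentiable at 0 \<Longrightarrow>
    ((\<lambda>t. f (x + t *\<^sub>R axis j 1)) has_real_derivative partial j f x) (at 0)"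
  unfolding partial_def by (simp add: DERIV_deriv_iff_real_differentiable)

lemma eventually_line_in:
  fixes x :: "real^'d::finite"
  assumes "open T" "x \<in> T"
  shows "eventually (\<lambda>t. x + t *\<^sub>R axis j 1 \<in> T) (nhds 0)"
proof -
  have "((\<lambda>t. x + t *\<^sub>R axis j 1) \<longlongrightarrow> x + 0 *\<^sub>R axis j 1) (nhds 0)"
    by (intro tendsto_intros filterlim_ident)
  with assms show ?thesis
    by (simp add: topological_tendstoD)
qed

lemma partial_cong:
  assumes "open T" "x \<in> T" "\<And>y. y \<in> T \<Longrightarrow> f y = g y"
  shows "partial j f x = partial j g x"
  unfolding partial_def
  by (rule deriv_cong_ev) (auto intro: eventually_mono[OF eventually_line_in[OF assms(1,2)]] assms(3))

lemma line_differentiable_cong: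
  fixes f g :: "real^'d::finite \<Rightarrow> real"
  assumes "open T" "x \<in> T" "\<And>y. y \<in> T \<Longrightarrow> f y = g y"
    and "(\<lambda>t. f (x + t *\<^sub>R axis j 1)) differentiable at 0"
  shows "(\<lambda>t. g (x + t *\<^sub>R axis j 1)) differentiable at 0"
proof -
  have "eventually (\<lambda>t. f (x + t *\<^sub>R axis j 1) = g (x + t *\<^sub>R axis j 1)) (nhds 0)"
    by (rule eventually_mono[OF eventually_line_in[OF assms(1,2)]]) (rule assms(3))
  then have "((\<lambda>t. f (x + t *\<^sub>R axis j 1)) has_real_derivative D) (at 0) \<longleftrightarrow>
      ((\<lambda>t. g (x + t *\<^sub>R axis j 1)) has_real_derivative D) (at 0)" for D
    by (intro DERIV_cong_ev) auto
  with assms(4) show ?thesis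
    unfolding real_differentiable_def by simp
qed

section \<open>Calculus of the classes C^k on an open set\<close>

lemma Ck_on_continuous: "Ck_on k T f \<Longrightarrow> continuous_on T f"
  by (cases k) auto

lemma Ck_on_Suc_imp: "Ck_on (Suc k) T f \<Longrightarrow> Ck_on k T f"
  by (induction k arbitrary: f) auto

lemma Ck_on_mono: "Ck_on n T f \<Longrightarrow> m \<le> n \<Longrightarrow> Ck_on m T f"
  by (induction n) (auto simp: le_Suc_eq dest: Ck_on_Suc_imp simp del: Ck_on.simps(2))

lemma Ck_on_differentiable:
  "Ck_on k T f \<Longrightarrow> 0 < k \<Longrightarrow> x \<in> T \<Longrightarrow> (\<lambda>t. f (x + t *\<^sub>R axis j 1)) differentiable at 0"
  by (cases k) auto

lemma Ck_on_partial: "Ck_on (Suc k) T f \<Longrightarrow> Ck_on k T (partial j f)"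
  by simp

text \<open>The sum and product rules identify a partial derivative with an explicit expression only
  at points of T, since the functions are arbitrary elsewhere. Openness of T makes agreement on T
  enough.\<close>

lemma Ck_on_cong:
  assumes "open T" "\<And>x. x \<in> T \<Longrightarrow> f x = g x" "Ck_on k T f"
  shows "Ck_on k T g"
  using assms(2,3)
proof (induction k arbitrary: f g)
  case 0
  then show ?case using continuous_on_cong[of T T f g] by auto
next
  case (Suc k)
  have "continuous_on T g"
    using Suc.prems continuous_on_cong[of T T f g] by auto
  moreover have "(\<lambda>t. g (x + t *\<^sub>R axis j 1)) differentiable at 0" if "x \<in> T" for x j
    using Suc.prems that assms(1) line_differentiable_cong[of T x f g j] by auto
  moreover have "Ck_on k T (partial j g)" for j
  proof (rule Suc.IH)
    show "partial j f x = partial j g x" if "x \<in> T" for x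
      using assms(1) that Suc.prems(1) by (rule partial_cong)
    show "Ck_on k T (partial j f)"
      using Suc.prems(2) by simp
  qed
  ultimately show ?case by simp
qed

lemma partial_const [simp]: "partial j (\<lambda>x. c) = (\<lambda>x. 0)"
  by (intro ext partial_eqI) auto

lemma Ck_on_const: "Ck_on k T (\<lambda>x. c)"
  by (induction k arbitrary: c) auto

lemma partial_add:
  assumes "(\<lambda>t. f (x + t *\<^sub>R axis j 1)) differentiable at 0"
    and "(\<lambda>t. g (x + t *\<^sub>R axis j 1)) differentiable at 0"
  shows "partial j (\<lambda>y. f y + g y) x = partial j f x + partial j g x"
  by (intro partial_eqI DERIV_add has_derivative_partial assms)

lemma partial_mult:
  assumes "(\<lambda>t. f (x + t *\<^sub>R axis j 1)) differentiable at 0"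
    and "(\<lambda>t. g (x + t *\<^sub>R axis j 1)) differentiable at 0"
  shows "partial j (\<lambda>y. f y * g y) x = partial j f x * g x + f x * partial j g x"
  by (rule partial_eqI)
    (use DERIV_mult[OF has_derivative_partial[OF assms(1)] has_derivative_partial[OF assms(2)]]
      in \<open>simp add: ac_simps\<close>)

lemma Ck_on_add:
  assumes "open T"
  shows "Ck_on k T f \<Longrightarrow> Ck_on k T g \<Longrightarrow> Ck_on k T (\<lambda>x. f x + g x)"
proof (induction k arbitrary: f g)
  case 0
  then show ?case by (auto intro: continuous_intros)
next
  case (Suc k)
  have "Ck_on k T (partial j (\<lambda>x. f x + g x))" for j
    by (rule Ck_on_cong[OF assms _ Suc.IH[of "partial j f" "partial j g"]])
      (use Suc.prems in \<open>auto simp: partial_add\<close>)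
  then show ?case
    using Suc.prems by (auto intro!: continuous_intros differentiable_add)
qed

lemma Ck_on_mult:
  assumes "open T"
  shows "Ck_on k T f \<Longrightarrow> Ck_on k T g \<Longrightarrow> Ck_on k T (\<lambda>x. f x * g x)"
proof (induction k arbitrary: f g)
  case 0
  then show ?case by (auto intro: continuous_intros)
next
  case (Suc k)
  have "Ck_on k T (partial j (\<lambda>x. f x * g x))" for j
  proof (rule Ck_on_cong[OF assms])
    show "Ck_on k T (\<lambda>x. partial j f x * g x + f x * partial j g x)"
      using Suc.prems Suc.prems[THEN Ck_on_Suc_imp]
      by (intro Ck_on_add[OF assms] Suc.IH) auto
  qed (use Suc.prems in \<open>auto simp: partial_mult\<close>)
  then show ?case
    using Suc.prems by (auto intro!: continuous_intros differentiable_mult)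
qed

lemma Ck_on_sum:
  assumes "open T" "\<And>a. a \<in> A \<Longrightarrow> Ck_on k T (f a)"
  shows "Ck_on k T (\<lambda>x. \<Sum>a\<in>A. f a x)"
  using assms(2)
  by (induction A rule: infinite_finite_induct) (auto intro: Ck_on_add assms(1) Ck_on_const)

lemma partial_sum:
  assumes "\<And>a. a \<in> A \<Longrightarrow> (\<lambda>t. f a (x + t *\<^sub>R axis j 1)) differentiable at 0"
  shows "partial j (\<lambda>y. \<Sum>a\<in>A. c a * f a y) x = (\<Sum>a\<in>A. c a * partial j (f a) x)"
  by (intro partial_eqI DERIV_sum DERIV_cmult has_derivative_partial assms)

text \<open>\<open>foldr\<close> applies the last direction of the list first. Reverse induction
  therefore peels off the innermost derivative, with the function generalised; the later lemmas on
  iterated derivatives follow the same pattern.\<close>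

lemma iter_partial_cong:
  assumes "open T" "x \<in> T" "\<And>y. y \<in> T \<Longrightarrow> f y = g y"
  shows "foldr partial js f x = foldr partial js g x"
  using assms(2,3)
proof (induction js arbitrary: f g x rule: rev_induct)
  case (snoc j js)
  have "foldr partial js (partial j f) x = foldr partial js (partial j g) x"
    by (rule snoc.IH[OF snoc.prems(1)]) (rule partial_cong[OF assms(1) _ snoc.prems(2)])
  then show ?case by simp
qed auto

lemma iter_partial_sum:
  assumes "open T" "x \<in> T" "\<And>a. a \<in> A \<Longrightarrow> Ck_on (length js) T (f a)"
  shows "foldr partial js (\<lambda>y. \<Sum>a\<in>A. c a * f a y) x = (\<Sum>a\<in>A. c a * foldr partial js (f a) x)"
  using assms(2,3)
proof (induction js arbitrary: f x rule: rev_induct)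
  case (snoc j js)
  have "foldr partial js (partial j (\<lambda>y. \<Sum>a\<in>A. c a * f a y)) x =
      foldr partial js (\<lambda>y. \<Sum>a\<in>A. c a * partial j (f a) y) x"
    using snoc.prems by (intro iter_partial_cong[OF assms(1)]) (auto intro: partial_sum)
  also have "\<dots> = (\<Sum>a\<in>A. c a * foldr partial js (partial j (f a)) x)"
    using snoc.prems by (intro snoc.IH) auto
  finally show ?case by simp
qed auto

lemma iter_partial_lincomb:
  assumes "open T" "x \<in> T" "Ck_on (length js) T f" "Ck_on (length js) T g"
  shows "foldr partial js (\<lambda>y. c * f y + d * g y) x =
    c * foldr partial js f x + d * foldr partial js g x"
  \<comment> \<open>A combination of two functions is a sum indexed by \<open>bool\<close>.\<close>
  using iter_partial_sum[OF assms(1,2), of UNIV js "\<lambda>b. if b then f else g" "\<lambda>b. if b then c else d"]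
    assms(3,4) by (simp add: UNIV_bool add.commute)

lemma iter_partial_zero: "foldr partial js (\<lambda>x. 0) = (\<lambda>x. 0)"
  by (induction js) auto

section \<open>Monomials about a centre and their derivatives there\<close>

definition centred_monomial :: "'d::finite set \<Rightarrow> real^'d \<Rightarrow> nat^'d \<Rightarrow> real^'d \<Rightarrow> real"
  where "centred_monomial I z \<alpha> x = (\<Prod>j\<in>I. (x $ j - z $ j) ^ (\<alpha> $ j))"

text \<open>Truncated subtraction leaves \<alpha> unchanged when its entry at j is 0. This is
  harmless in the derivative formula, where the factor \<alpha>_j then vanishes.\<close>

definition mi_dec :: "'d::finite \<Rightarrow> nat^'d \<Rightarrow> nat^'d"
  where "mi_dec j \<alpha> = (\<chi> k. if k = j then \<alpha> $ k - 1 else \<alpha> $ k)"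

lemma mi_dec_nth: "mi_dec j \<alpha> $ k = (if k = j then \<alpha> $ k - 1 else \<alpha> $ k)"
  by (simp add: mi_dec_def)

lemma mi_abs_mi_dec:
  assumes "\<alpha> $ j > 0"
  shows "mi_abs \<alpha> = Suc (mi_abs (mi_dec j \<alpha>))"
proof -
  have "(\<Sum>k\<in>UNIV - {j}. mi_dec j \<alpha> $ k) = (\<Sum>k\<in>UNIV - {j}. \<alpha> $ k)"
    by (rule sum.cong) (auto simp: mi_dec_nth)
  with assms show ?thesis
    unfolding mi_abs_def by (simp add: sum.remove[of UNIV j] mi_dec_nth)
qed

lemma centred_monomial_derivative:
  "((\<lambda>t. centred_monomial UNIV z \<alpha> (x + t *\<^sub>R axis j 1)) has_real_derivative
     real (\<alpha> $ j) * centred_monomial UNIV z (mi_dec j \<alpha>) x) (at 0)"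
proof -
  have split: "centred_monomial UNIV z \<alpha> (x + t *\<^sub>R axis j 1) =
      (x $ j + t - z $ j) ^ (\<alpha> $ j) * (\<Prod>k\<in>UNIV - {j}. (x $ k - z $ k) ^ (\<alpha> $ k))" for t
  proof -
    have "(\<Prod>k\<in>UNIV - {j}. ((x + t *\<^sub>R axis j 1) $ k - z $ k) ^ (\<alpha> $ k)) =
        (\<Prod>k\<in>UNIV - {j}. (x $ k - z $ k) ^ (\<alpha> $ k))"
      by (rule prod.cong) (auto simp: axis_def)
    then show ?thesis
      unfolding centred_monomial_def by (simp add: prod.remove[of UNIV j] axis_def)
  qed
  have dec: "centred_monomial UNIV z (mi_dec j \<alpha>) x =
      (x $ j - z $ j) ^ (\<alpha> $ j - 1) * (\<Prod>k\<in>UNIV - {j}. (x $ k - z $ k) ^ (\<alpha> $ k))"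
  proof -
    have "(\<Prod>k\<in>UNIV - {j}. (x $ k - z $ k) ^ (mi_dec j \<alpha> $ k)) =
        (\<Prod>k\<in>UNIV - {j}. (x $ k - z $ k) ^ (\<alpha> $ k))"
      by (rule prod.cong) (auto simp: mi_dec_nth)
    then show ?thesis
      unfolding centred_monomial_def by (simp add: prod.remove[of UNIV j] mi_dec_nth)
  qed
  show ?thesis
    unfolding split dec by (auto intro!: derivative_eq_intros)
qed

lemma partial_centred_monomial:
  "partial j (centred_monomial UNIV z \<alpha>) =
    (\<lambda>x. real (\<alpha> $ j) * centred_monomial UNIV z (mi_dec j \<alpha>) x)"
  by (intro ext partial_eqI centred_monomial_derivative)

lemma centred_monomial_differentiable:
  "(\<lambda>t. centred_monomial UNIV z \<alpha> (x + t *\<^sub>R axis j 1)) differentiable at 0"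
  using centred_monomial_derivative real_differentiable_def by blast

lemma Ck_on_centred_monomial:
  assumes "open T"
  shows "Ck_on k T (centred_monomial UNIV z \<alpha>)"
proof (induction k arbitrary: \<alpha>)
  case 0
  then show ?case
    unfolding centred_monomial_def[abs_def] by (auto intro!: continuous_intros)
next
  case (Suc k)
  have "Ck_on k T (partial j (centred_monomial UNIV z \<alpha>))" for j
    unfolding partial_centred_monomial
    by (intro Ck_on_mult assms Ck_on_const Suc.IH)
  moreover have "continuous_on T (centred_monomial UNIV z \<alpha>)"
    using Suc.IH by (rule Ck_on_continuous)
  ultimately show ?case by (simp add: centred_monomial_differentiable)
qed

lemma centred_monomial_centre:
  "centred_monomial UNIV z \<alpha> z = (if \<alpha> = 0 then 1 else 0)"
  by (auto simp: centred_monomial_def vec_eq_iff power_0_left)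

text \<open>At its centre a monomial survives differentiation only if every exponent is used up
  exactly, and then \<alpha>! remains. Only the multiplicities of the directions matter, not their
  order.\<close>

lemma iter_partial_centred_monomial:
  "foldr partial js (centred_monomial UNIV z \<alpha>) z =
    (if \<forall>j. count_list js j = \<alpha> $ j then \<Prod>j\<in>UNIV. fact (\<alpha> $ j) else 0)"
proof (induction js arbitrary: \<alpha> rule: rev_induct)
  case Nil
  then show ?case by (auto simp: centred_monomial_centre vec_eq_iff)
next
  case (snoc j js)
  have "foldr partial (js @ [j]) (centred_monomial UNIV z \<alpha>) z =
      real (\<alpha> $ j) * foldr partial js (centred_monomial UNIV z (mi_dec j \<alpha>)) z"
    \<comment> \<open>The sum over the one-element set \<open>{()}\<close> serves as the rule for
      scalar multiples.\<close>
    using iter_partial_sum[of UNIV z "{()}" js "\<lambda>_. centred_monomial UNIV z (mi_dec j \<alpha>)"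
        "\<lambda>_. real (\<alpha> $ j)"]
    by (simp add: partial_centred_monomial Ck_on_centred_monomial)
  also have "\<dots> = (if \<forall>k. count_list (js @ [j]) k = \<alpha> $ k then \<Prod>k\<in>UNIV. fact (\<alpha> $ k) else 0)"
  proof (cases "\<alpha> $ j = 0")
    case True
    then show ?thesis by (auto intro!: exI[of _ j])
  next
    case False
    have "(\<Prod>k\<in>UNIV - {j}. fact (mi_dec j \<alpha> $ k)) = (\<Prod>k\<in>UNIV - {j}. fact (\<alpha> $ k) :: real)"
      by (rule prod.cong) (auto simp: mi_dec_nth)
    then have "real (\<alpha> $ j) * (\<Prod>k\<in>UNIV. fact (mi_dec j \<alpha> $ k)) = (\<Prod>k\<in>UNIV. fact (\<alpha> $ k))"
      using False by (simp add: prod.remove[of UNIV j] mi_dec_nth fact_reduce[of "\<alpha> $ j"])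
    moreover have "(\<forall>k. count_list js k = mi_dec j \<alpha> $ k) \<longleftrightarrow>
        (\<forall>k. count_list (js @ [j]) k = \<alpha> $ k)"
      using False by (intro iff_allI) (auto simp: mi_dec_nth)
    ultimately show ?thesis by (simp add: snoc.IH)
  qed
  finally show ?case .
qed

lemma length_eq_mi_abs: "(\<forall>j. count_list js j = \<alpha> $ j) \<Longrightarrow> length js = mi_abs \<alpha>"
  by (metis (mono_tags, lifting) mi_abs_def sum.cong sum_count_set finite subset_UNIV)

text \<open>A factor that vanishes to the order of the derivative at the centre makes the other factor
  behave like a constant, which replaces the full Leibniz formula.\<close>

lemma iter_partial_mult_centred_monomial:
  assumes "open T" "z \<in> T" "Ck_on (length js) T c" "length js \<le> mi_abs \<alpha>"
  shows "foldr partial js (\<lambda>x. c x * centred_monomial UNIV z \<alpha> x) z =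
    c z * foldr partial js (centred_monomial UNIV z \<alpha>) z"
  using assms(3,4)
proof (induction js arbitrary: c \<alpha> rule: rev_induct)
  case (snoc j js)
  let ?M = "centred_monomial UNIV z"
  have c: "Ck_on (length js) T c" "Ck_on (length js) T (partial j c)"
    using snoc.prems(1) Ck_on_Suc_imp by auto
  have "foldr partial (js @ [j]) (\<lambda>x. c x * ?M \<alpha> x) z =
      foldr partial js (\<lambda>x. 1 * (partial j c x * ?M \<alpha> x) +
        real (\<alpha> $ j) * (c x * ?M (mi_dec j \<alpha>) x)) z"
    unfolding foldr_append foldr.simps comp_def id_def
    using snoc.prems(1)
    by (intro iter_partial_cong[OF assms(1,2)])
      (auto simp: partial_mult centred_monomial_differentiable partial_centred_monomial)
  also have "\<dots> = foldr partial js (\<lambda>x. partial j c x * ?M \<alpha> x) z +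
      real (\<alpha> $ j) * foldr partial js (\<lambda>x. c x * ?M (mi_dec j \<alpha>) x) z"
    using c by (subst iter_partial_lincomb[OF assms(1,2)])
      (auto intro!: Ck_on_mult Ck_on_centred_monomial assms(1))
  \<comment> \<open>Here |\<alpha>| exceeds the length of \<open>js\<close>, so the induction
    hypothesis, applied with the derivative of c as coefficient, leaves a derivative of too low an
    order to survive at the centre.\<close>
  also have "foldr partial js (\<lambda>x. partial j c x * ?M \<alpha> x) z = 0"
  proof -
    have "\<not> (\<forall>j. count_list js j = \<alpha> $ j)"
      using snoc.prems(2) length_eq_mi_abs[of js \<alpha>] by auto
    then show ?thesis
      using snoc.prems(2) by (auto simp: snoc.IH[OF c(2)] iter_partial_centred_monomial)
  qed
  also have "real (\<alpha> $ j) * foldr partial js (\<lambda>x. c x * ?M (mi_dec j \<alpha>) x) z =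
      c z * (real (\<alpha> $ j) * foldr partial js (?M (mi_dec j \<alpha>)) z)"
    using snoc.prems(2) snoc.IH[OF c(1), of "mi_dec j \<alpha>"] mi_abs_mi_dec[of \<alpha> j] by (cases "\<alpha> $ j = 0") auto
  also have "real (\<alpha> $ j) * foldr partial js (?M (mi_dec j \<alpha>)) z = foldr partial (js @ [j]) (?M \<alpha>) z"
    using iter_partial_sum[of UNIV z "{()}" js "\<lambda>_. ?M (mi_dec j \<alpha>)" "\<lambda>_. real (\<alpha> $ j)"]
    by (simp add: partial_centred_monomial Ck_on_centred_monomial)
  finally show ?case by simp
qed auto

subsection \<open>Polynomial spaces and restriction to a hyperplane\<close>

definition centred_space :: "'d::finite set \<Rightarrow> real^'d \<Rightarrow> int \<Rightarrow> (real^'d \<Rightarrow> real) set"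
  where "centred_space I z p = span {centred_monomial I z \<alpha> | \<alpha>. int (\<Sum>j\<in>I. \<alpha> $ j) \<le> p}"

lemma poly_space_eq_centred_space_0: "poly_space I p = centred_space I 0 p"
proof -
  have "centred_monomial I 0 = (\<lambda>\<alpha> x. \<Prod>j\<in>I. (x $ j) ^ (\<alpha> $ j))"
    by (intro ext) (simp add: centred_monomial_def)
  then show ?thesis
    unfolding poly_space_def centred_space_def by presburger
qed

lemma centred_monomial_in_centred_space:
  "int (\<Sum>j\<in>I. \<alpha> $ j) \<le> p \<Longrightarrow> centred_monomial I z \<alpha> \<in> centred_space I z p"
  unfolding centred_space_def by (rule span_base) blast

lemma centred_space_zero: "(\<lambda>x. 0) \<in> centred_space I z p"
  unfolding centred_space_def zero_fun_def[symmetric] by (rule span_zero)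

lemma centred_space_add:
  "f \<in> centred_space I z p \<Longrightarrow> g \<in> centred_space I z p \<Longrightarrow> (\<lambda>x. f x + g x) \<in> centred_space I z p"
  unfolding centred_space_def using span_add[of f _ g] by (simp add: plus_fun_def)

lemma centred_space_scale:
  "f \<in> centred_space I z p \<Longrightarrow> (\<lambda>x. c * f x) \<in> centred_space I z p"
  unfolding centred_space_def using span_scale[of f _ c] by (simp add: scaleR_fun_def)

lemma centred_space_induct [consumes 1, case_names monomial zero add scale]:
  assumes "f \<in> centred_space I z p"
    and "\<And>\<alpha>. int (\<Sum>j\<in>I. \<alpha> $ j) \<le> p \<Longrightarrow> P (centred_monomial I z \<alpha>)"
    and "P (\<lambda>x. 0)"
    and "\<And>f g. P f \<Longrightarrow> P g \<Longrightarrow> P (\<lambda>x. f x + g x)"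
    and "\<And>c f. P f \<Longrightarrow> P (\<lambda>x. c * f x)"
  shows "P f"
proof -
  have "subspace (Collect P)"
    using assms(3-5) by (intro subspaceI) (simp_all add: zero_fun_def plus_fun_def scaleR_fun_def)
  then show ?thesis
    using assms(1,2) unfolding centred_space_def by (elim span_induct) auto
qed

lemma centred_space_mult:
  assumes "f \<in> centred_space I z p" "g \<in> centred_space I z q"
  shows "(\<lambda>x. f x * g x) \<in> centred_space I z (p + q)"
  using assms(1)
proof (induction rule: centred_space_induct)
  case (monomial \<alpha>)
  show ?case
    using assms(2)
  proof (induction rule: centred_space_induct)
    case (monomial \<beta>)
    have "(\<lambda>x. centred_monomial I z \<alpha> x * centred_monomial I z \<beta> x) =
        centred_monomial I z (\<alpha> + \<beta>)"
      by (simp add: centred_monomial_def fun_eq_iff power_add prod.distrib)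
    then show ?case
      using monomial \<open>int (\<Sum>j\<in>I. \<alpha> $ j) \<le> p\<close>
      by (auto intro!: centred_monomial_in_centred_space simp: sum.distrib)
  next
    case (add f g)
    then show ?case
      using centred_space_add[of "\<lambda>x. centred_monomial I z \<alpha> x * f x" I z "p + q"]
      by (simp add: distrib_left)
  next
    case (scale c f)
    then show ?case
      using centred_space_scale[of "\<lambda>x. centred_monomial I z \<alpha> x * f x" I z "p + q" c]
      by (simp add: ac_simps)
  qed (simp add: centred_space_zero)
next
  case (add f h)
  then show ?case
    using centred_space_add[of "\<lambda>x. f x * g x" I z "p + q"] by (simp add: distrib_right)
next
  case (scale c f)
  then show ?case
    using centred_space_scale[of "\<lambda>x. f x * g x" I z "p + q" c] by (simp add: ac_simps)
qed (simp add: centred_space_zero)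

lemma centred_space_const: "0 \<le> p \<Longrightarrow> (\<lambda>x. c) \<in> centred_space I z p"
  using centred_space_scale[OF centred_monomial_in_centred_space[of 0 I p z], of c]
  by (simp add: centred_monomial_def[abs_def])

lemma centred_space_coordinate:
  fixes I :: "'d::finite set"
  assumes "j \<in> I"
  shows "(\<lambda>x. x $ j - c) \<in> centred_space I z 1"
proof -
  let ?e = "(\<chi> k. if k = j then 1 else 0) :: nat^'d"
  have e: "(\<Sum>k\<in>I. ?e $ k) = 1"
    using assms by (simp add: sum.delta)
  have "centred_monomial I z ?e = (\<lambda>x. \<Prod>k\<in>I. if k = j then x $ k - z $ k else 1)"
    unfolding centred_monomial_def by (intro ext prod.cong) auto
  also have "\<dots> = (\<lambda>x. x $ j - z $ j)"
    using assms by (simp add: prod.delta)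
  finally have "(\<lambda>x. x $ j - z $ j) \<in> centred_space I z 1"
    using centred_monomial_in_centred_space[of ?e I 1 z] e by simp
  from centred_space_add[OF this centred_space_const[of 1 "z $ j - c"]]
  show ?thesis by simp
qed

lemma centred_space_power:
  assumes "f \<in> centred_space I z 1"
  shows "(\<lambda>x. f x ^ n) \<in> centred_space I z (int n)"
proof (induction n)
  case (Suc n)
  show ?case
    using centred_space_mult[OF assms Suc] by simp
qed (simp add: centred_space_const)

lemma centred_space_mono: "p \<le> q \<Longrightarrow> f \<in> centred_space I z p \<Longrightarrow> f \<in> centred_space I z q"
  using span_mono[of "{centred_monomial I z \<alpha> |\<alpha>. int (\<Sum>j\<in>I. \<alpha> $ j) \<le> p}"
      "{centred_monomial I z \<alpha> |\<alpha>. int (\<Sum>j\<in>I. \<alpha> $ j) \<le> q}"]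
  by (force simp: centred_space_def)

text \<open>Each factor x_j - w_j is affine about z, and degrees add under multiplication. The
  freedom J \<subseteq> I lets the same argument serve for a change of centre and for an enlargement
  of the set of variables.\<close>

lemma centred_monomial_recentre:
  assumes "J \<subseteq> I"
  shows "centred_monomial J w \<alpha> \<in> centred_space I z (int (\<Sum>j\<in>J. \<alpha> $ j))"
proof -
  have "finite J" by simp
  then show ?thesis using assms
  proof (induction J rule: finite_induct)
    case empty
    then show ?case by (simp add: centred_monomial_def[abs_def] centred_space_const)
  next
    case (insert j J)
    then show ?case
      using centred_space_mult[OF
          centred_space_power[OF centred_space_coordinate[of j I "w $ j" z], of "\<alpha> $ j"], of "centred_monomial J w \<alpha>" "int (\<Sum>j\<in>J. \<alpha> $ j)"]
      by (simp add: centred_monomial_def[abs_def])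
  qed
qed

lemma centred_space_subset: "centred_space I w p \<subseteq> centred_space I z p"
proof
  fix f assume "f \<in> centred_space I w p"
  then show "f \<in> centred_space I z p"
  proof (induction rule: centred_space_induct)
    case (monomial \<alpha>)
    then show ?case
      using centred_monomial_recentre[of I I w \<alpha> z] centred_space_mono by blast
  qed (simp_all add: centred_space_zero centred_space_add centred_space_scale)
qed

lemma poly_space_eq_centred_space: "poly_space I p = centred_space I z p"
  unfolding poly_space_eq_centred_space_0 by (intro equalityI centred_space_subset)

lemma finite_mi_abs_le: "finite {\<alpha> :: nat^'d::finite. mi_abs \<alpha> \<le> p}"
proof (rule finite_subset)
  show "{\<alpha> :: nat^'d. mi_abs \<alpha> \<le> p} \<subseteq> vec_lambda ` (\<Pi>\<^sub>E j\<in>UNIV. {..p})"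
  proof
    fix \<alpha> :: "nat^'d" assume "\<alpha> \<in> {\<alpha>. mi_abs \<alpha> \<le> p}"
    then have "\<alpha> $ j \<le> p" for j
      using member_le_sum[of j UNIV "\<lambda>j. \<alpha> $ j"] by (simp add: mi_abs_def)
    then have "vec_nth \<alpha> \<in> (\<Pi>\<^sub>E j\<in>UNIV. {..p})" by auto
    then show "\<alpha> \<in> vec_lambda ` (\<Pi>\<^sub>E j\<in>UNIV. {..p})"
      by (metis image_eqI vec_nth_inverse)
  qed
qed (simp add: finite_PiE)

lemma poly_space_coefficients:
  fixes v :: "real^'d::finite \<Rightarrow> real"
  assumes "v \<in> poly_space UNIV (int p)"
  shows "\<exists>a. v = (\<lambda>x. \<Sum>\<alpha> | mi_abs \<alpha> \<le> p. a \<alpha> * centred_monomial UNIV z \<alpha> x)"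
  using assms unfolding poly_space_eq_centred_space[of _ _ z]
proof (induction rule: centred_space_induct)
  case (monomial \<alpha>)
  then have le: "mi_abs \<alpha> \<le> p"
    by (simp add: mi_abs_def del: of_nat_sum)
  let ?a = "\<lambda>\<beta>. if \<beta> = \<alpha> then 1 else 0"
  have "(\<lambda>x. \<Sum>\<beta> | mi_abs \<beta> \<le> p. ?a \<beta> * centred_monomial UNIV z \<beta> x) =
      (\<lambda>x. \<Sum>\<beta> | mi_abs \<beta> \<le> p. if \<beta> = \<alpha> then centred_monomial UNIV z \<beta> x else 0)"
    by (intro ext sum.cong) auto
  also have "\<dots> = centred_monomial UNIV z \<alpha>"
    using le by (simp add: sum.delta finite_mi_abs_le)
  finally show ?case by (intro exI[of _ ?a]) simp
next
  case zero
  show ?case by (intro exI[of _ "\<lambda>_. 0"]) simp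
next
  case (add f g)
  then obtain a b where "f = (\<lambda>x. \<Sum>\<alpha> | mi_abs \<alpha> \<le> p. a \<alpha> * centred_monomial UNIV z \<alpha> x)"
    "g = (\<lambda>x. \<Sum>\<alpha> | mi_abs \<alpha> \<le> p. b \<alpha> * centred_monomial UNIV z \<alpha> x)" by blast
  then show ?case
    by (intro exI[of _ "\<lambda>\<alpha>. a \<alpha> + b \<alpha>"]) (simp add: distrib_right sum.distrib)
next
  case (scale c f)
  then obtain a where "f = (\<lambda>x. \<Sum>\<alpha> | mi_abs \<alpha> \<le> p. a \<alpha> * centred_monomial UNIV z \<alpha> x)" by blast
  then show ?case
    by (intro exI[of _ "\<lambda>\<alpha>. c * a \<alpha>"]) (simp add: sum_distrib_left mult.assoc)
qed

lemma centred_space_sum: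
  "(\<And>a. a \<in> A \<Longrightarrow> f a \<in> centred_space I z p) \<Longrightarrow> (\<lambda>x. \<Sum>a\<in>A. c a * f a x) \<in> centred_space I z p"
  by (induction A rule: infinite_finite_induct)
    (auto intro!: centred_space_zero centred_space_add centred_space_scale)

lemma sum_monomials_in_poly_space:
  "(\<lambda>x. \<Sum>\<alpha> | mi_abs \<alpha> \<le> p. a \<alpha> * centred_monomial UNIV z \<alpha> x) \<in> poly_space UNIV (int p)"
  unfolding poly_space_eq_centred_space[of _ _ z]
  by (intro centred_space_sum centred_monomial_in_centred_space) (simp add: mi_abs_def del: of_nat_sum)

lemma Ck_on_poly_space:
  assumes "open T" "v \<in> poly_space UNIV p"
  shows "Ck_on k T v"
  using assms(2) unfolding poly_space_eq_centred_space_0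
  by (induction rule: centred_space_induct)
    (auto intro!: Ck_on_centred_monomial Ck_on_const Ck_on_add Ck_on_mult assms(1))

lemma poly_space_differentiable:
  "v \<in> poly_space UNIV p \<Longrightarrow> (\<lambda>t. v (x + t *\<^sub>R axis j 1)) differentiable at 0"
  by (rule Ck_on_differentiable[of 1 UNIV]) (simp_all add: Ck_on_poly_space del: Ck_on.simps One_nat_def)

lemma partial_scale:
  "(\<lambda>t. f (x + t *\<^sub>R axis j 1)) differentiable at 0 \<Longrightarrow>
    partial j (\<lambda>y. c * f y) x = c * partial j f x"
  by (intro partial_eqI DERIV_cmult has_derivative_partial)

lemma partial_in_poly_space:
  assumes "v \<in> poly_space UNIV p"
  shows "partial j v \<in> poly_space UNIV (p - 1)"
proof -
  \<comment> \<open>Membership of v is carried through the induction because additivity of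
    \<open>partial\<close> needs both summands to be differentiable.\<close>
  have "v \<in> poly_space UNIV p \<and> partial j v \<in> poly_space UNIV (p - 1)"
    using assms unfolding poly_space_eq_centred_space_0
  proof (induction rule: centred_space_induct)
    case (monomial \<alpha>)
    show ?case
    proof (cases "\<alpha> $ j = 0")
      case True
      then show ?thesis
        using monomial by (simp add: partial_centred_monomial centred_space_zero centred_monomial_in_centred_space)
    next
      case False
      then have "int (\<Sum>k\<in>UNIV. mi_dec j \<alpha> $ k) \<le> p - 1"
        using mi_abs_mi_dec[of \<alpha> j] monomial by (simp add: mi_abs_def)
      then show ?thesis
        using monomial by (simp add: partial_centred_monomial centred_space_scale centred_monomial_in_centred_space)
    qed
  next
    case (add f g)
    then have "partial j (\<lambda>x. f x + g x) = (\<lambda>x. partial j f x + partial j g x)"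
      by (intro ext partial_add) (auto intro: poly_space_differentiable[unfolded poly_space_eq_centred_space_0])
    with add show ?case by (simp add: centred_space_add)
  next
    case (scale c f)
    then have "partial j (\<lambda>x. c * f x) = (\<lambda>x. c * partial j f x)"
      by (intro ext partial_scale) (auto intro: poly_space_differentiable[unfolded poly_space_eq_centred_space_0])
    with scale show ?case by (simp add: centred_space_scale)
  qed (simp add: centred_space_zero)
  then show ?thesis ..
qed

section \<open>Restriction to the hyperplane and polynomials with given data\<close>

lemma restrict_first_in_poly_space:
  fixes v :: "real^'d::{finite,linorder} \<Rightarrow> real"
  assumes "v \<in> poly_space UNIV p"
  shows "restrict_first c v \<in> poly_space (UNIV - {first_coord}) p"
  using assms unfolding poly_space_eq_centred_space_0
proof (induction rule: centred_space_induct)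
  case (monomial \<alpha>)
  let ?I = "UNIV - {first_coord :: 'd}"
  have "(\<Prod>j\<in>?I. (if j = first_coord then c else x $ j) ^ (\<alpha> $ j)) = (\<Prod>j\<in>?I. x $ j ^ (\<alpha> $ j))" for x
    by (rule prod.cong) auto
  then have "restrict_first c (centred_monomial UNIV 0 \<alpha>) =
      (\<lambda>x. c ^ (\<alpha> $ first_coord) * centred_monomial ?I 0 \<alpha> x)"
    by (simp add: restrict_first_def centred_monomial_def fun_eq_iff prod.remove[of UNIV first_coord])
  moreover have "(\<Sum>j\<in>?I. \<alpha> $ j) \<le> (\<Sum>j\<in>UNIV. \<alpha> $ j)"
    by (rule sum_mono2) auto
  ultimately show ?case
    using monomial by (auto intro!: centred_space_scale centred_monomial_in_centred_space simp del: of_nat_sum)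
next
  case (add f g)
  then show ?case
    using centred_space_add[OF add] by (simp add: restrict_first_def)
next
  case (scale k f)
  then show ?case
    using centred_space_scale[OF scale, of k] by (simp add: restrict_first_def)
qed (simp add: restrict_first_def centred_space_zero)

lemma poly_space_mono_vars:
  assumes "J \<subseteq> I"
  shows "poly_space J p \<subseteq> poly_space I p"
proof
  fix f assume "f \<in> poly_space J p"
  then show "f \<in> poly_space I p"
    unfolding poly_space_eq_centred_space_0
  proof (induction rule: centred_space_induct)
    case (monomial \<alpha>)
    then show ?case
      using centred_monomial_recentre[OF assms, of 0 \<alpha> 0] centred_space_mono by blast
  qed (simp_all add: centred_space_zero centred_space_add centred_space_scale)
qed

lemma restrict_first_ident:
  fixes f :: "real^'d::{finite,linorder} \<Rightarrow> real"
  assumes "f \<in> poly_space (UNIV - {first_coord}) p"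
  shows "restrict_first c f = f"
  using assms unfolding poly_space_eq_centred_space_0
proof (induction rule: centred_space_induct)
  case (monomial \<alpha>)
  show ?case
    unfolding restrict_first_def centred_monomial_def by (intro ext prod.cong) auto
qed (simp_all add: restrict_first_def fun_eq_iff)

text \<open>The witness is the first-order expansion f + (x_1 - c) g in the normal variable. Its
  degree stays within p because g has degree at most p - 1.\<close>

lemma poly_with_cauchy_data:
  fixes f g :: "real^'d::{finite,linorder} \<Rightarrow> real"
  assumes f: "f \<in> poly_space (UNIV - {first_coord}) p"
    and g: "g \<in> poly_space (UNIV - {first_coord}) (p - 1)"
  shows "\<exists>v\<in>poly_space UNIV p. restrict_first c v = f \<and> restrict_first c (partial first_coord v) = g"
proof -
  define v where "v = (\<lambda>x. f x + (x $ first_coord - c) * g x)"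
  \<comment> \<open>Elements of the space in the remaining variables are functions on all of R^d
    that do not see x_1, as they equal their own restriction.\<close>
  have inv: "h (x + t *\<^sub>R axis first_coord 1) = h x"
    if "h \<in> poly_space (UNIV - {first_coord}) q" for h q x t
  proof -
    have "h = restrict_first 0 h" using restrict_first_ident[OF that] by simp
    then have "h (x + t *\<^sub>R axis first_coord 1) = restrict_first 0 h (x + t *\<^sub>R axis first_coord 1)" by simp
    also have "\<dots> = restrict_first 0 h x"
      unfolding restrict_first_def by (intro arg_cong[of _ _ h]) (simp add: vec_eq_iff axis_def)
    finally show ?thesis using restrict_first_ident[OF that] by simp
  qed
  have "partial first_coord v = g"
  proof (intro ext partial_eqI)
    fix x
    have "((\<lambda>t. f x + (x $ first_coord + t - c) * g x) has_real_derivative g x) (at 0)"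
      by (auto intro!: derivative_eq_intros)
    then show "((\<lambda>t. v (x + t *\<^sub>R axis first_coord 1)) has_real_derivative g x) (at 0)"
      by (simp add: v_def inv[OF f] inv[OF g])
  qed
  moreover have "restrict_first c v = f"
    using restrict_first_ident[OF f, of c] by (simp add: v_def restrict_first_def fun_eq_iff)
  moreover have "v \<in> poly_space UNIV p"
  proof -
    have "f \<in> poly_space UNIV p" "g \<in> poly_space UNIV (p - 1)"
      using f g poly_space_mono_vars[of "UNIV - {first_coord}" UNIV] by auto
    then show ?thesis
      unfolding v_def poly_space_eq_centred_space_0
      using centred_space_mult[OF centred_space_coordinate, of first_coord UNIV g 0 "p - 1" c]
      by (auto intro: centred_space_add)
  qed
  ultimately show ?thesis
    using restrict_first_ident[OF g] by auto
qed

text \<open>A line in a direction tangential to the hyperplane stays in it, so both sides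
  differentiate the same function of t; no smoothness enters.\<close>

lemma restrict_first_partial:
  assumes "j \<noteq> first_coord"
  shows "restrict_first c (partial j f) = partial j (restrict_first c f)"
proof
  fix x
  let ?R = "\<lambda>x. \<chi> j. if j = first_coord then c else x $ j"
  have "?R (x + t *\<^sub>R axis j 1) = ?R x + t *\<^sub>R axis j 1" for t
    using assms by (auto simp: vec_eq_iff axis_def)
  then show "restrict_first c (partial j f) x = partial j (restrict_first c f) x"
    by (simp add: restrict_first_def partial_def)
qed

lemma restrict_first_iter_partial:
  "first_coord \<notin> set js \<Longrightarrow>
    restrict_first c (foldr partial js f) = foldr partial js (restrict_first c f)"
  by (induction js) (auto simp: restrict_first_partial)

lemma restrict_first_centre: "restrict_first (z $ first_coord) f z = f z"
proof -
  have "(\<chi> j. if j = first_coord then z $ first_coord else z $ j) = z"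
    by (simp add: vec_eq_iff)
  then show ?thesis by (simp add: restrict_first_def)
qed

text \<open>Writing a multi-index as a list of directions turns D^i into a single
  \<open>foldr\<close>, which makes induction on the order of the derivative possible.\<close>

definition mi_list :: "'d::finite list \<Rightarrow> nat^'d \<Rightarrow> 'd list"
  where "mi_list js i = concat (map (\<lambda>j. replicate (i $ j) j) js)"

lemma foldr_replicate_funpow: "foldr h (replicate n j) g = (h j ^^ n) g"
  by (induction n) auto

lemma mi_deriv_eq: "mi_deriv i f = foldr partial (mi_list (sorted_list_of_set UNIV) i) f"
proof -
  have "foldr (\<lambda>j g. (partial j ^^ (i $ j)) g) js f = foldr partial (mi_list js i) f" for js
    by (induction js) (auto simp: mi_list_def foldr_replicate_funpow)
  then show ?thesis by (simp add: mi_deriv_def)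
qed

lemma count_list_mi_list:
  "distinct js \<Longrightarrow> count_list (mi_list js i) j = (if j \<in> set js then i $ j else 0)"
proof -
  have rep: "count_list (replicate n k) j = (if k = j then n else 0)" for n k
    by (induction n) auto
  show "distinct js \<Longrightarrow> ?thesis"
    by (induction js) (auto simp: mi_list_def rep)
qed

subsection \<open>The quasi-Trefftz conditions as a triangular system\<close>

lemma length_mi_list:
  assumes "distinct js" "set js = UNIV"
  shows "length (mi_list js i) = mi_abs i"
  using assms by (intro length_eq_mi_abs) (simp add: count_list_mi_list)

lemma iter_partial_mult_sum:
  assumes "open T" "x \<in> T" "Ck_on (length js) T c" "\<And>a. a \<in> A \<Longrightarrow> Ck_on (length js) T (v a)"
  shows "foldr partial js (\<lambda>y. c y * (\<Sum>a\<in>A. r a * v a y)) x =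
    (\<Sum>a\<in>A. r a * foldr partial js (\<lambda>y. c y * v a y) x)"
proof -
  have "(\<lambda>y. c y * (\<Sum>a\<in>A. r a * v a y)) = (\<lambda>y. \<Sum>a\<in>A. r a * (c y * v a y))"
    by (simp add: sum_distrib_left mult.left_commute)
  then show ?thesis
    using assms by (simp add: iter_partial_sum Ck_on_mult)
qed

text \<open>Differentiating the monomial costs one degree, which the strict inequality compensates:
  the coefficient can still be frozen at the centre. If \<alpha>_m = 0, both sides vanish.\<close>

lemma iter_partial_mult_partial_centred_monomial:
  assumes "open T" "z \<in> T" "Ck_on (length js) T c" "length js < mi_abs \<alpha>"
  shows "foldr partial js (\<lambda>x. c x * partial m (centred_monomial UNIV z \<alpha>) x) z =
    c z * foldr partial (js @ [m]) (centred_monomial UNIV z \<alpha>) z"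
proof -
  let ?M = "centred_monomial UNIV z (mi_dec m \<alpha>)"
  have "foldr partial js (\<lambda>x. c x * partial m (centred_monomial UNIV z \<alpha>) x) z =
      real (\<alpha> $ m) * foldr partial js (\<lambda>x. c x * ?M x) z"
    using iter_partial_mult_sum[OF assms(1-3), of "{()}" "\<lambda>_. ?M" "\<lambda>_. real (\<alpha> $ m)"] assms(1)
    by (simp add: partial_centred_monomial Ck_on_centred_monomial)
  also have "\<dots> = c z * (real (\<alpha> $ m) * foldr partial js ?M z)"
    using assms mi_abs_mi_dec[of \<alpha> m] by (cases "\<alpha> $ m = 0") (simp_all add: iter_partial_mult_centred_monomial)
  also have "real (\<alpha> $ m) * foldr partial js ?M z = foldr partial (js @ [m]) (centred_monomial UNIV z \<alpha>) z"
    using iter_partial_sum[of UNIV z "{()}" js "\<lambda>_. ?M" "\<lambda>_. real (\<alpha> $ m)"]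
    by (simp add: partial_centred_monomial Ck_on_centred_monomial)
  finally show ?thesis .
qed

lemma diff_op_eq:
  "diff_op K \<beta> \<sigma> v = (\<lambda>x. (\<Sum>j\<in>UNIV. partial j
     (\<lambda>y. - (\<Sum>m\<in>UNIV. K y $ j $ m * partial m v y) + \<beta> y $ j * v y) x) + \<sigma> x * v x)"
  by (simp add: diff_op_def divergence_def gradient_def matrix_vector_mult_def fun_eq_iff ac_simps)

text \<open>The operator is kept in divergence form: the outer derivative joins the list as the
  direction j. This is why K and \<beta> need one derivative more than \<sigma>.\<close>

lemma iter_partial_diff_op:
  assumes T: "open T" "x \<in> T"
    and K: "\<And>j m. Ck_on (Suc (length js)) T (\<lambda>x. K x $ j $ m)"
    and \<beta>: "\<And>j. Ck_on (Suc (length js)) T (\<lambda>x. \<beta> x $ j)"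
    and \<sigma>: "Ck_on (length js) T \<sigma>"
    and v: "v \<in> poly_space UNIV q"
  shows "foldr partial js (diff_op K \<beta> \<sigma> v) x =
    (\<Sum>j\<in>UNIV. - (\<Sum>m\<in>UNIV. foldr partial (js @ [j]) (\<lambda>y. K y $ j $ m * partial m v y) x) +
      foldr partial (js @ [j]) (\<lambda>y. \<beta> y $ j * v y) x) + foldr partial js (\<lambda>y. \<sigma> y * v y) x"
proof -
  define F where "F = (\<lambda>j y. - (\<Sum>m\<in>UNIV. K y $ j $ m * partial m v y) + \<beta> y $ j * v y)"
  note Ckv = Ck_on_poly_space[OF T(1) v] Ck_on_poly_space[OF T(1) partial_in_poly_space[OF v]]
  have K_dv: "Ck_on (Suc (length js)) T (\<lambda>y. K y $ j $ m * partial m v y)" for j m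
    by (intro Ck_on_mult T K Ckv)
  have \<beta>_v: "Ck_on (Suc (length js)) T (\<lambda>y. \<beta> y $ j * v y)" for j
    by (intro Ck_on_mult T \<beta> Ckv)
  have \<sigma>_v: "Ck_on (length js) T (\<lambda>y. \<sigma> y * v y)"
    by (intro Ck_on_mult T \<sigma> Ckv)
  \<comment> \<open>The factors 1 and -1 bring the expression into the shape of
    \<open>iter_partial_lincomb\<close> and \<open>iter_partial_sum\<close>.\<close>
  have F_eq: "F j = (\<lambda>y. (-1) * (\<Sum>m\<in>UNIV. 1 * (K y $ j $ m * partial m v y)) + 1 * (\<beta> y $ j * v y))" for j
    by (simp add: F_def)
  have S: "Ck_on (Suc (length js)) T (\<lambda>y. \<Sum>m\<in>UNIV. 1 * (K y $ j $ m * partial m v y))" for j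
    using K_dv by (intro Ck_on_sum T) (simp del: Ck_on.simps)
  have "Ck_on (Suc (length js)) T (F j)" for j
    unfolding F_eq by (intro Ck_on_add[OF T(1)] Ck_on_mult[OF T(1)] Ck_on_const S \<beta>_v)
  then have F: "Ck_on (length js) T (partial j (F j))" for j
    by (rule Ck_on_partial)
  have inner: "foldr partial js (partial j (F j)) x =
      - (\<Sum>m\<in>UNIV. foldr partial (js @ [j]) (\<lambda>y. K y $ j $ m * partial m v y) x) +
      foldr partial (js @ [j]) (\<lambda>y. \<beta> y $ j * v y) x" for j
  proof -
    have "foldr partial js (partial j (F j)) x = foldr partial (js @ [j]) (F j) x" by simp
    also have "\<dots> = (-1) * foldr partial (js @ [j]) (\<lambda>y. \<Sum>m\<in>UNIV. 1 * (K y $ j $ m * partial m v y)) x +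
        1 * foldr partial (js @ [j]) (\<lambda>y. \<beta> y $ j * v y) x"
      unfolding F_eq
      by (intro iter_partial_lincomb T)
        (use S \<beta>_v T in \<open>simp_all del: Ck_on.simps mult_1 mult_1_left\<close>)
    also have "foldr partial (js @ [j]) (\<lambda>y. \<Sum>m\<in>UNIV. 1 * (K y $ j $ m * partial m v y)) x =
        (\<Sum>m\<in>UNIV. 1 * foldr partial (js @ [j]) (\<lambda>y. K y $ j $ m * partial m v y) x)"
      by (rule iter_partial_sum[OF T]) (use K_dv in \<open>simp del: Ck_on.simps\<close>)
    finally show ?thesis by simp
  qed
  have "diff_op K \<beta> \<sigma> v = (\<lambda>x. 1 * (\<Sum>j\<in>UNIV. 1 * partial j (F j) x) + 1 * (\<sigma> x * v x))"
    by (simp add: diff_op_eq F_def)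
  then have "foldr partial js (diff_op K \<beta> \<sigma> v) x =
      1 * foldr partial js (\<lambda>x. \<Sum>j\<in>UNIV. 1 * partial j (F j) x) x + 1 * foldr partial js (\<lambda>y. \<sigma> y * v y) x"
    using F \<sigma>_v T by (simp only:) (intro iter_partial_lincomb T Ck_on_sum, auto)
  also have "foldr partial js (\<lambda>x. \<Sum>j\<in>UNIV. 1 * partial j (F j) x) x =
      (\<Sum>j\<in>UNIV. 1 * foldr partial js (partial j (F j)) x)"
    by (rule iter_partial_sum[OF T F])
  finally show ?thesis by (simp add: inner)
qed

text \<open>The condition \<open>K_nz\<close> is what ellipticity at the centre gives when tested
  with e_1. The subtractions in the orders of smoothness are truncated at 0.\<close>

locale quasi_trefftz_setup =
  fixes T :: "'d::{finite,linorder} point set" and z :: "'d point" and p :: nat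
    and K :: "'d matrix_field" and \<beta> :: "'d vector_field" and \<sigma> :: "'d scalar_field"
  assumes T: "open T" "z \<in> T"
    and Ck_K: "\<And>j m. Ck_on (p - 1) T (\<lambda>x. K x $ j $ m)"
    and Ck_\<beta>: "\<And>j. Ck_on (p - 1) T (\<lambda>x. \<beta> x $ j)"
    and Ck_\<sigma>: "Ck_on (p - 2) T \<sigma>"
    and K_nz: "K z $ first_coord $ first_coord \<noteq> 0"
begin

abbreviation M :: "'d multi_index \<Rightarrow> 'd scalar_field"
  where "M \<equiv> centred_monomial UNIV z"

abbreviation QT :: "'d scalar_field set"
  where "QT \<equiv> quasi_trefftz K \<beta> \<sigma> z p"

definition condition :: "'d multi_index \<Rightarrow> 'd scalar_field \<Rightarrow> real"
  where "condition i v = mi_deriv i (diff_op K \<beta> \<sigma> v) z"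

definition index_list :: "'d multi_index \<Rightarrow> 'd list"
  where "index_list = mi_list (sorted_list_of_set UNIV)"

lemma length_index_list: "length (index_list i) = mi_abs i"
  by (simp add: index_list_def length_mi_list)

lemma count_index_list: "count_list (index_list i) j = i $ j"
  by (simp add: index_list_def count_list_mi_list)

lemma condition_eq:
  assumes "mi_abs i + 2 \<le> p" "v \<in> poly_space UNIV q"
  shows "condition i v =
    (\<Sum>j\<in>UNIV. - (\<Sum>m\<in>UNIV. foldr partial (index_list i @ [j]) (\<lambda>y. K y $ j $ m * partial m v y) z) +
      foldr partial (index_list i @ [j]) (\<lambda>y. \<beta> y $ j * v y) z) +
      foldr partial (index_list i) (\<lambda>y. \<sigma> y * v y) z"
  unfolding condition_def mi_deriv_eq index_list_def[symmetric]
  by (intro iter_partial_diff_op[OF T _ _ _ assms(2)]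
      Ck_on_mono[OF Ck_K] Ck_on_mono[OF Ck_\<beta>] Ck_on_mono[OF Ck_\<sigma>])
    (use assms(1) in \<open>simp_all add: length_index_list\<close>)

lemma condition_sum:
  assumes i: "mi_abs i + 2 \<le> p" and v: "\<And>a. a \<in> A \<Longrightarrow> v a \<in> poly_space UNIV q"
  shows "condition i (\<lambda>x. \<Sum>a\<in>A. r a * v a x) = (\<Sum>a\<in>A. r a * condition i (v a))"
proof -
  let ?l = "index_list i"
  have sum: "(\<lambda>x. \<Sum>a\<in>A. r a * v a x) \<in> poly_space UNIV q"
    using v unfolding poly_space_eq_centred_space_0 by (rule centred_space_sum)
  have Ckv: "Ck_on k T (v a)" "Ck_on k T (partial m (v a))" if "a \<in> A" for k m a
    using Ck_on_poly_space[OF T(1)] v[OF that] partial_in_poly_space by blast+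
  \<comment> \<open>The products with K and \<beta> are differentiated |i| + 1 times, the one with
    \<sigma> |i| times. As the hypothesis forces p \<ge> 2, truncation loses nothing here.\<close>
  have le: "Suc (mi_abs i) \<le> p - 1" "mi_abs i \<le> p - 2"
    using i by auto
  have partial_v: "partial m (\<lambda>x. \<Sum>a\<in>A. r a * v a x) = (\<lambda>x. \<Sum>a\<in>A. r a * partial m (v a) x)" for m
    using v by (intro ext partial_sum poly_space_differentiable)
  have 1: "foldr partial (?l @ [j]) (\<lambda>y. K y $ j $ m * partial m (\<lambda>x. \<Sum>a\<in>A. r a * v a x) y) z =
      (\<Sum>a\<in>A. r a * foldr partial (?l @ [j]) (\<lambda>y. K y $ j $ m * partial m (v a) y) z)" for j m
    unfolding partial_v
    by (intro iter_partial_mult_sum[OF T])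
      (use Ckv le in \<open>auto simp: length_index_list simp del: Ck_on.simps intro: Ck_on_mono[OF Ck_K]\<close>)
  have 2: "foldr partial (?l @ [j]) (\<lambda>y. \<beta> y $ j * (\<Sum>a\<in>A. r a * v a y)) z =
      (\<Sum>a\<in>A. r a * foldr partial (?l @ [j]) (\<lambda>y. \<beta> y $ j * v a y) z)" for j
    by (intro iter_partial_mult_sum[OF T])
      (use Ckv le in \<open>auto simp: length_index_list simp del: Ck_on.simps intro: Ck_on_mono[OF Ck_\<beta>]\<close>)
  have 3: "foldr partial ?l (\<lambda>y. \<sigma> y * (\<Sum>a\<in>A. r a * v a y)) z =
      (\<Sum>a\<in>A. r a * foldr partial ?l (\<lambda>y. \<sigma> y * v a y) z)"
    by (intro iter_partial_mult_sum[OF T])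
      (use Ckv le in \<open>auto simp: length_index_list simp del: Ck_on.simps intro: Ck_on_mono[OF Ck_\<sigma>]\<close>)
  have swap: "(\<Sum>j\<in>UNIV. \<Sum>m\<in>UNIV. \<Sum>a\<in>A. X a j m) = (\<Sum>a\<in>A. \<Sum>j\<in>UNIV. \<Sum>m\<in>UNIV. X a j m)"
    for X :: "_ \<Rightarrow> 'd \<Rightarrow> 'd \<Rightarrow> real"
  proof -
    have "(\<Sum>j\<in>UNIV. \<Sum>m\<in>UNIV. \<Sum>a\<in>A. X a j m) = (\<Sum>j\<in>UNIV. \<Sum>a\<in>A. \<Sum>m\<in>UNIV. X a j m)"
      by (intro sum.cong refl sum.swap)
    also have "\<dots> = (\<Sum>a\<in>A. \<Sum>j\<in>UNIV. \<Sum>m\<in>UNIV. X a j m)"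
      by (rule sum.swap)
    finally show ?thesis .
  qed
  have swap2: "(\<Sum>j\<in>UNIV. \<Sum>a\<in>A. X a j) = (\<Sum>a\<in>A. \<Sum>j\<in>UNIV. X a j)"
    for X :: "_ \<Rightarrow> 'd \<Rightarrow> real" by (rule sum.swap)
  have "(\<Sum>a\<in>A. r a * condition i (v a)) = (\<Sum>a\<in>A. r a *
    ((\<Sum>j\<in>UNIV. - (\<Sum>m\<in>UNIV. foldr partial (?l @ [j]) (\<lambda>y. K y $ j $ m * partial m (v a) y) z) +
      foldr partial (?l @ [j]) (\<lambda>y. \<beta> y $ j * v a y) z) +
      foldr partial ?l (\<lambda>y. \<sigma> y * v a y) z))"
    by (rule sum.cong[OF refl]) (simp only: condition_eq[OF i v])
  also have "\<dots> = condition i (\<lambda>x. \<Sum>a\<in>A. r a * v a x)"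
    unfolding condition_eq[OF i sum] 1 2 3
    by (simp only: sum.distrib sum_negf swap swap2 distrib_left sum_distrib_left
        mult_minus_right)
  finally show ?thesis ..
qed

section \<open>Entries of the system: the conditions on monomials\<close>

lemma condition_monomial:
  assumes i: "mi_abs i + 2 \<le> p" and \<alpha>: "mi_abs i + 2 \<le> mi_abs \<alpha>"
  shows "condition i (M \<alpha>) =
    - (\<Sum>j\<in>UNIV. \<Sum>m\<in>UNIV. K z $ j $ m * foldr partial (index_list i @ [j, m]) (M \<alpha>) z)"
proof -
  let ?l = "index_list i"
  have poly: "M \<alpha> \<in> poly_space UNIV (int (mi_abs \<alpha>))"
    unfolding poly_space_eq_centred_space[of _ _ z] mi_abs_def
    by (rule centred_monomial_in_centred_space) simp
  have le: "Suc (mi_abs i) \<le> p - 1" "mi_abs i \<le> p - 2"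
    using i by auto
  \<comment> \<open>This disposes of the terms with \<beta> and \<sigma>: they apply at most |i| + 1
    derivatives, fewer than |\<alpha>|. The term with K reaches order |i| + 2 and can
    survive.\<close>
  have zero: "foldr partial js (M \<alpha>) z = 0" if "length js < mi_abs \<alpha>" for js
    using that length_eq_mi_abs[of js \<alpha>] by (auto simp: iter_partial_centred_monomial)
  have 1: "foldr partial (?l @ [j]) (\<lambda>y. K y $ j $ m * partial m (M \<alpha>) y) z =
      K z $ j $ m * foldr partial (?l @ [j, m]) (M \<alpha>) z" for j m
    using iter_partial_mult_partial_centred_monomial[OF T, of "?l @ [j]" "\<lambda>y. K y $ j $ m" \<alpha> m]
      Ck_on_mono[OF Ck_K le(1)] \<alpha> by (simp add: length_index_list del: Ck_on.simps)
  have 2: "foldr partial (?l @ [j]) (\<lambda>y. \<beta> y $ j * M \<alpha> y) z = 0" for j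
    using iter_partial_mult_centred_monomial[OF T, of "?l @ [j]" "\<lambda>y. \<beta> y $ j" \<alpha>]
      Ck_on_mono[OF Ck_\<beta> le(1)] \<alpha> zero[of "?l @ [j]"] by (simp add: length_index_list del: Ck_on.simps foldr_append)
  have 3: "foldr partial ?l (\<lambda>y. \<sigma> y * M \<alpha> y) z = 0"
    using iter_partial_mult_centred_monomial[OF T, of ?l \<sigma> \<alpha>]
      Ck_on_mono[OF Ck_\<sigma> le(2)] \<alpha> zero[of ?l] by (simp add: length_index_list del: Ck_on.simps)
  show ?thesis
    unfolding condition_eq[OF i poly] 1 2 3 by (simp add: sum_negf)
qed

text \<open>The condition with index \<open>dec2 \<alpha>\<close> serves to determine the coefficient of \<open>M \<alpha>\<close>.\<close>

definition dec2 :: "'d multi_index \<Rightarrow> 'd multi_index"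
  where "dec2 \<alpha> = mi_dec first_coord (mi_dec first_coord \<alpha>)"

lemma dec2_nth: "dec2 \<alpha> $ k = (if k = first_coord then \<alpha> $ k - 2 else \<alpha> $ k)"
  by (simp add: dec2_def mi_dec_nth numeral_2_eq_2)

lemma mi_abs_dec2: "2 \<le> \<alpha> $ first_coord \<Longrightarrow> mi_abs \<alpha> = mi_abs (dec2 \<alpha>) + 2"
  using mi_abs_mi_dec[of \<alpha> first_coord] mi_abs_mi_dec[of "mi_dec first_coord \<alpha>" first_coord]
  by (simp add: dec2_def mi_dec_nth)

lemma condition_diagonal:
  assumes "mi_abs \<alpha> \<le> p" "2 \<le> \<alpha> $ first_coord"
  shows "condition (dec2 \<alpha>) (M \<alpha>) \<noteq> 0"
proof -
  let ?c = "\<lambda>j m. K z $ j $ m * foldr partial (index_list (dec2 \<alpha>) @ [j, m]) (M \<alpha>) z"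
  \<comment> \<open>Two entries of \<open>first_coord\<close> are missing in the list of
    \<open>dec2 \<alpha>\<close>, so only j = m = \<open>first_coord\<close> completes it to
    \<alpha>, and K_11 \<alpha>! is the only term of the double sum.\<close>
  have count: "(\<forall>k. count_list (index_list (dec2 \<alpha>) @ [j, m]) k = \<alpha> $ k) \<longleftrightarrow>
      j = first_coord \<and> m = first_coord" (is "?lhs j m \<longleftrightarrow> _") for j m
  proof
    assume "?lhs j m"
    then have "count_list (index_list (dec2 \<alpha>) @ [j, m]) first_coord = \<alpha> $ first_coord" by blast
    with assms show "j = first_coord \<and> m = first_coord"
      by (auto simp: count_index_list dec2_nth split: if_splits)
  qed (use assms in \<open>auto simp: count_index_list dec2_nth\<close>)
  have "?c j m = (if j = first_coord \<and> m = first_coord then K z $ j $ m * (\<Prod>k\<in>UNIV. fact (\<alpha> $ k)) else 0)" for j m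
    by (simp only: iter_partial_centred_monomial count) simp
  then have "(\<Sum>j\<in>UNIV. \<Sum>m\<in>UNIV. ?c j m) = (\<Sum>j\<in>UNIV. \<Sum>m\<in>UNIV. if m = first_coord then
      (if j = first_coord then K z $ j $ m * (\<Prod>k\<in>UNIV. fact (\<alpha> $ k)) else 0) else 0)"
    by (intro sum.cong refl) simp
  also have "\<dots> = K z $ first_coord $ first_coord * (\<Prod>k\<in>UNIV. fact (\<alpha> $ k))"
    by simp
  finally show ?thesis
    using assms K_nz mi_abs_dec2[of \<alpha>] by (simp add: condition_monomial)
qed

text \<open>This encodes the lexicographic order of the pairs (|\<alpha>|, \<alpha>_1) in one
  number. As \<alpha>_1 \<le> |\<alpha>|, the second summand cannot bridge the gap between
  consecutive squares.\<close>

definition rank :: "'d multi_index \<Rightarrow> nat"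
  where "rank \<alpha> = mi_abs \<alpha> ^ 2 + \<alpha> $ first_coord"

text \<open>If the degree of \<gamma> is not smaller, only the principal part at the centre is left,
  and a nonzero entry forces \<gamma> = \<open>dec2 \<alpha>\<close> + e_j + e_m. The degrees then
  agree, and since \<gamma> \<noteq> \<alpha> one of the two directions is not the first, which
  lowers the exponent of x_1.\<close>

lemma condition_off_diagonal:
  assumes \<alpha>: "mi_abs \<alpha> \<le> p" "2 \<le> \<alpha> $ first_coord"
    and "\<gamma> \<noteq> \<alpha>" "condition (dec2 \<alpha>) (M \<gamma>) \<noteq> 0"
  shows "rank \<gamma> < rank \<alpha>"
proof (cases "mi_abs \<gamma> < mi_abs \<alpha>")
  case True
  have "\<gamma> $ first_coord \<le> mi_abs \<gamma>"
    unfolding mi_abs_def by (rule member_le_sum) auto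
  then have "rank \<gamma> < (mi_abs \<gamma> + 1)\<^sup>2"
    by (simp add: rank_def power2_eq_square)
  also have "\<dots> \<le> (mi_abs \<alpha>)\<^sup>2"
    using True by (intro power_mono) auto
  finally show ?thesis by (simp add: rank_def)
next
  case False
  let ?l = "index_list (dec2 \<alpha>)"
  have "\<exists>j m. foldr partial (?l @ [j, m]) (M \<gamma>) z \<noteq> 0"
  proof (rule ccontr)
    assume "\<not> ?thesis"
    then have "condition (dec2 \<alpha>) (M \<gamma>) = 0"
      using False \<alpha> mi_abs_dec2[of \<alpha>] by (subst condition_monomial) auto
    then show False using assms(4) by simp
  qed
  then obtain j m where count: "\<And>k. count_list (?l @ [j, m]) k = \<gamma> $ k"
    unfolding iter_partial_centred_monomial by meson
  have abs: "mi_abs \<gamma> = mi_abs \<alpha>"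
    using length_eq_mi_abs[of "?l @ [j, m]" \<gamma>] count mi_abs_dec2[OF \<alpha>(2)]
    by (simp add: length_index_list)
  have "j \<noteq> first_coord \<or> m \<noteq> first_coord"
  proof (rule ccontr)
    assume "\<not> ?thesis"
    then have "\<gamma> $ k = \<alpha> $ k" for k
      using count[of k] \<alpha>(2) by (auto simp: count_index_list dec2_nth split: if_splits)
    then show False using assms(3) by (simp add: vec_eq_iff)
  qed
  then have "\<gamma> $ first_coord < \<alpha> $ first_coord"
    using count[of first_coord] \<alpha>(2) by (auto simp: count_index_list dec2_nth split: if_splits)
  with abs show ?thesis by (simp add: rank_def)
qed

definition indices :: "'d multi_index set"
  where "indices = {\<alpha>. mi_abs \<alpha> \<le> p}"

definition bound_indices :: "'d multi_index set"
  where "bound_indices = {\<alpha>. mi_abs \<alpha> \<le> p \<and> 2 \<le> \<alpha> $ first_coord}"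

lemma finite_indices: "finite indices"
  by (simp add: indices_def finite_mi_abs_le)

lemma bound_indices_subset: "bound_indices \<subseteq> indices"
  by (auto simp: indices_def bound_indices_def)

lemma monomial_in_poly_space: "\<alpha> \<in> indices \<Longrightarrow> M \<alpha> \<in> poly_space UNIV (int p)"
  unfolding poly_space_eq_centred_space[of _ _ z] indices_def mi_abs_def
  by (intro centred_monomial_in_centred_space) (simp del: of_nat_sum)

text \<open>On \<open>bound_indices\<close> the map \<open>dec2\<close> is a bijection onto the
  indices of the conditions, its inverse adding 2 to the first entry. The system is thus square in
  the bound coefficients. For p < 2 both sides impose no condition.\<close>

lemma quasi_trefftz_iff:
  "v \<in> QT \<longleftrightarrow> v \<in> poly_space UNIV (int p) \<and> (\<forall>\<alpha>\<in>bound_indices. condition (dec2 \<alpha>) v = 0)"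
proof -
  have "(\<forall>i. int (mi_abs i) \<le> int p - 2 \<longrightarrow> condition i v = 0) \<longleftrightarrow>
      (\<forall>\<alpha>\<in>bound_indices. condition (dec2 \<alpha>) v = 0)" (is "?L \<longleftrightarrow> ?R")
  proof
    assume ?L
    then show ?R using mi_abs_dec2 by (auto simp: bound_indices_def)
  next
    assume R: ?R
    show ?L
    proof (intro allI impI)
      fix i :: "'d multi_index" assume i: "int (mi_abs i) \<le> int p - 2"
      define \<alpha> :: "'d multi_index" where "\<alpha> = (\<chi> k. if k = first_coord then i $ k + 2 else i $ k)"
      have \<alpha>: "dec2 \<alpha> = i" "2 \<le> \<alpha> $ first_coord"
        by (auto simp: vec_eq_iff dec2_nth \<alpha>_def)
      then have "\<alpha> \<in> bound_indices"
        using i mi_abs_dec2[of \<alpha>] by (simp add: bound_indices_def)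
      with R \<alpha>(1) show "condition i v = 0" by auto
    qed
  qed
  then show ?thesis
    by (simp add: quasi_trefftz_def condition_def)
qed

lemma condition_dec2_sum:
  assumes "\<alpha> \<in> bound_indices" "\<And>a. a \<in> A \<Longrightarrow> v a \<in> poly_space UNIV (int p)"
  shows "condition (dec2 \<alpha>) (\<lambda>x. \<Sum>a\<in>A. r a * v a x) = (\<Sum>a\<in>A. r a * condition (dec2 \<alpha>) (v a))"
  using assms mi_abs_dec2[of \<alpha>] by (intro condition_sum) (auto simp: bound_indices_def)

lemma quasi_trefftz_sum:
  assumes "\<And>a. a \<in> A \<Longrightarrow> v a \<in> QT"
  shows "(\<lambda>x. \<Sum>a\<in>A. r a * v a x) \<in> QT"
proof -
  have v: "v a \<in> poly_space UNIV (int p)" "\<alpha> \<in> bound_indices \<Longrightarrow> condition (dec2 \<alpha>) (v a) = 0"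
    if "a \<in> A" for a \<alpha>
    using assms[OF that] by (auto simp: quasi_trefftz_iff)
  have "(\<lambda>x. \<Sum>a\<in>A. r a * v a x) \<in> poly_space UNIV (int p)"
    using v(1) unfolding poly_space_eq_centred_space_0 by (rule centred_space_sum)
  then show ?thesis
    using v by (simp add: quasi_trefftz_iff condition_dec2_sum)
qed

lemma subspace_quasi_trefftz: "subspace QT"
proof (rule subspaceI)
  show "0 \<in> QT"
    using quasi_trefftz_sum[of "{}" "\<lambda>_. 0"] by (simp add: zero_fun_def)
  show "v + w \<in> QT" if "v \<in> QT" "w \<in> QT" for v w
    using quasi_trefftz_sum[of UNIV "\<lambda>b. if b then v else w" "\<lambda>_. 1"] that
    by (simp add: UNIV_bool plus_fun_def add.commute)
  show "c *\<^sub>R v \<in> QT" if "v \<in> QT" for c v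
    using quasi_trefftz_sum[of "{()}" "\<lambda>_. v" "\<lambda>_. c"] that by (simp add: scaleR_fun_def)
qed

section \<open>Cauchy data on the hyperplane through the centre\<close>

abbreviation trace :: "'d scalar_field \<Rightarrow> 'd scalar_field"
  where "trace \<equiv> restrict_first (z $ first_coord)"

lemma trace_monomial: "0 < \<alpha> $ first_coord \<Longrightarrow> trace (M \<alpha>) x = 0"
  unfolding restrict_first_def centred_monomial_def
  by (rule prod_zero) (auto intro!: bexI[of _ first_coord])

lemma trace_partial_monomial: "2 \<le> \<alpha> $ first_coord \<Longrightarrow> trace (partial first_coord (M \<alpha>)) x = 0"
  using trace_monomial[of "mi_dec first_coord \<alpha>" x]
  by (simp add: partial_centred_monomial restrict_first_def mi_dec_nth)

lemma trace_sum: "trace (\<lambda>x. \<Sum>\<alpha>\<in>A. a \<alpha> * M \<alpha> x) x = (\<Sum>\<alpha>\<in>A. a \<alpha> * trace (M \<alpha>) x)"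
  by (simp add: restrict_first_def)

lemma trace_partial_sum: "trace (partial j (\<lambda>x. \<Sum>\<alpha>\<in>A. a \<alpha> * M \<alpha> x)) x =
    (\<Sum>\<alpha>\<in>A. a \<alpha> * trace (partial j (M \<alpha>)) x)"
  by (simp add: restrict_first_def partial_sum centred_monomial_differentiable)

text \<open>A polynomial with the right data is corrected in its bound coefficients only. Their
  monomials contain (x_1 - z_1)^2, so the correction changes neither the trace nor the normal
  derivative.\<close>

lemma exists_cauchy_data:
  assumes f: "f \<in> poly_space (UNIV - {first_coord}) (int p)"
    and g: "g \<in> poly_space (UNIV - {first_coord}) (int p - 1)"
  shows "\<exists>v\<in>QT. trace v = f \<and> trace (partial first_coord v) = g"
proof -
  obtain v0 where v0: "v0 \<in> poly_space UNIV (int p)" "trace v0 = f" "trace (partial first_coord v0) = g"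
    using poly_with_cauchy_data[OF f g] by blast
  obtain a0 where a0: "v0 = (\<lambda>x. \<Sum>\<alpha>\<in>indices. a0 \<alpha> * M \<alpha> x)"
    using poly_space_coefficients[OF v0(1)] unfolding indices_def by blast
  obtain a where a: "\<And>\<alpha>. \<alpha> \<notin> bound_indices \<Longrightarrow> a \<alpha> = a0 \<alpha>"
    and eq: "\<And>\<alpha>. \<alpha> \<in> bound_indices \<Longrightarrow> (\<Sum>\<gamma>\<in>indices. a \<gamma> * condition (dec2 \<alpha>) (M \<gamma>)) = 0"
    using triangular_solvable[OF finite_indices bound_indices_subset,
        of "\<lambda>\<alpha> \<gamma>. condition (dec2 \<alpha>) (M \<gamma>)" rank a0]
      condition_diagonal condition_off_diagonal
    unfolding bound_indices_def by blast
  define v where "v = (\<lambda>x. \<Sum>\<alpha>\<in>indices. a \<alpha> * M \<alpha> x)"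
  \<comment> \<open>A weight that vanishes on the bound indices sees only the coefficients at which
    \<open>a\<close> and \<open>a0\<close> agree.\<close>
  have same: "(\<Sum>\<alpha>\<in>indices. a \<alpha> * t \<alpha>) = (\<Sum>\<alpha>\<in>indices. a0 \<alpha> * t \<alpha>)"
    if "\<And>\<alpha>. \<alpha> \<in> bound_indices \<Longrightarrow> t \<alpha> = 0" for t
    by (rule sum.cong[OF refl]) (metis a that mult_zero_right)
  have "v \<in> QT"
    unfolding quasi_trefftz_iff
    using eq sum_monomials_in_poly_space[of a z p]
    by (auto simp: v_def condition_dec2_sum monomial_in_poly_space indices_def[symmetric])
  moreover have "trace v = trace v0"
    unfolding v_def a0 fun_eq_iff trace_sum
    by (intro allI same trace_monomial) (simp add: bound_indices_def)
  moreover have "trace (partial first_coord v) = trace (partial first_coord v0)"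
    unfolding v_def a0 fun_eq_iff trace_partial_sum
    by (intro allI same trace_partial_monomial) (simp add: bound_indices_def)
  ultimately show ?thesis using v0 by auto
qed

text \<open>Tangential derivatives of the data at the centre recover the free coefficients: v yields
  those with \<alpha>_1 = 0 and its normal derivative those with \<alpha>_1 = 1. With these zero,
  the triangular system forces the others to vanish.\<close>

lemma zero_cauchy_data:
  assumes v: "v \<in> QT" "trace v = 0" "trace (partial first_coord v) = 0"
  shows "v = 0"
proof -
  obtain a where a: "v = (\<lambda>x. \<Sum>\<alpha>\<in>indices. a \<alpha> * M \<alpha> x)"
    using poly_space_coefficients[of v p z] v(1) unfolding indices_def quasi_trefftz_iff by blast
  have coeff: "foldr partial js v z = a \<alpha> * (\<Prod>k\<in>UNIV. fact (\<alpha> $ k))"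
    if "\<alpha> \<in> indices" "\<And>k. count_list js k = \<alpha> $ k" for js \<alpha>
  proof -
    have "foldr partial js (M \<gamma>) z = (if \<gamma> = \<alpha> then \<Prod>k\<in>UNIV. fact (\<alpha> $ k) else 0)" for \<gamma>
      using that(2) by (auto simp: iter_partial_centred_monomial vec_eq_iff)
    moreover have "foldr partial js v z = (\<Sum>\<gamma>\<in>indices. a \<gamma> * foldr partial js (M \<gamma>) z)"
      unfolding a by (rule iter_partial_sum[OF T]) (rule Ck_on_centred_monomial[OF T(1)])
    ultimately show ?thesis
      using that(1) by (simp add: finite_indices if_distrib[of "\<lambda>y. _ * y"] cong: if_cong)
  qed
  have free: "a \<alpha> = 0" if \<alpha>: "\<alpha> \<in> indices - bound_indices" for \<alpha>
  proof -
    \<comment> \<open>Only tangential directions are listed, so these derivatives commute with the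
      trace.\<close>
    define js where "js = mi_list (sorted_list_of_set (UNIV - {first_coord})) \<alpha>"
    have count: "count_list js k = (if k = first_coord then 0 else \<alpha> $ k)" for k
      by (simp add: js_def count_list_mi_list)
    have js: "foldr partial js w z = 0" if "trace w = 0" for w
    proof -
      have "first_coord \<notin> set js"
        using count[of first_coord] by (simp add: count_list_0_iff)
      then have "trace (foldr partial js w) z = foldr partial js (\<lambda>x. 0) z"
        using that by (simp add: restrict_first_iter_partial zero_fun_def)
      then show ?thesis by (simp add: restrict_first_centre iter_partial_zero)
    qed
    have "\<alpha> $ first_coord = 0 \<or> \<alpha> $ first_coord = 1"
      using \<alpha> by (auto simp: indices_def bound_indices_def)
    then have "a \<alpha> * (\<Prod>k\<in>UNIV. fact (\<alpha> $ k)) = 0"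
    proof
      assume "\<alpha> $ first_coord = 0"
      then have "foldr partial js v z = a \<alpha> * (\<Prod>k\<in>UNIV. fact (\<alpha> $ k))"
        using \<alpha> count by (intro coeff) auto
      then show ?thesis using js[OF v(2)] by simp
    next
      assume "\<alpha> $ first_coord = 1"
      \<comment> \<open>The direction at the end of the list acts first, so this is the tangential
        derivative of the normal derivative of v.\<close>
      then have "foldr partial (js @ [first_coord]) v z = a \<alpha> * (\<Prod>k\<in>UNIV. fact (\<alpha> $ k))"
        using \<alpha> count by (intro coeff) auto
      then show ?thesis using js[OF v(3)] by simp
    qed
    then show ?thesis by simp
  qed
  have eq: "(\<Sum>\<gamma>\<in>indices. a \<gamma> * condition (dec2 \<alpha>) (M \<gamma>)) = 0" if "\<alpha> \<in> bound_indices" for \<alpha>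
    using v(1) that condition_dec2_sum[OF that, of indices M a]
    by (simp add: quasi_trefftz_iff monomial_in_poly_space flip: a)
  have "a \<alpha> = 0" if "\<alpha> \<in> indices" for \<alpha>
    using triangular_unique[OF finite_indices bound_indices_subset, of "\<lambda>\<alpha> \<gamma>. condition (dec2 \<alpha>) (M \<gamma>)" rank a,
        OF _ _ free eq that]
      condition_diagonal condition_off_diagonal
    unfolding bound_indices_def by blast
  then show ?thesis by (simp add: a zero_fun_def)
qed

lemma quasi_trefftz_diff: "v \<in> QT \<Longrightarrow> w \<in> QT \<Longrightarrow> v - w \<in> QT"
  using subspace_quasi_trefftz by (rule subspace_diff)

lemma trace_add: "trace (v + w) = trace v + trace w"
  by (simp add: restrict_first_def plus_fun_def)

lemma trace_scale: "trace (c *\<^sub>R v) = c *\<^sub>R trace v"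
  by (simp add: restrict_first_def scaleR_fun_def)

lemma quasi_trefftz_differentiable:
  "v \<in> QT \<Longrightarrow> (\<lambda>t. v (x + t *\<^sub>R axis j 1)) differentiable at 0"
  using poly_space_differentiable quasi_trefftz_iff by blast

lemma partial_add_quasi_trefftz:
  "v \<in> QT \<Longrightarrow> w \<in> QT \<Longrightarrow> partial j (v + w) = partial j v + partial j w"
  using partial_add[of v _ j w] by (simp add: plus_fun_def fun_eq_iff quasi_trefftz_differentiable)

lemma partial_scale_quasi_trefftz: "v \<in> QT \<Longrightarrow> partial j (c *\<^sub>R v) = c *\<^sub>R partial j v"
  using partial_scale[of v _ j c] by (simp add: scaleR_fun_def fun_eq_iff quasi_trefftz_differentiable)

lemma unique_cauchy_data:
  assumes f: "f \<in> poly_space (UNIV - {first_coord}) (int p)"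
    and g: "g \<in> poly_space (UNIV - {first_coord}) (int p - 1)"
  shows "\<exists>!v. v \<in> QT \<and> trace v = f \<and> trace (partial first_coord v) = g"
proof -
  have "v = w" if v: "v \<in> QT" "trace v = f" "trace (partial first_coord v) = g"
    and w: "w \<in> QT" "trace w = f" "trace (partial first_coord w) = g" for v w
  proof -
    \<comment> \<open>Additivity of \<open>partial\<close> is known for sums within QT, so the
      difference is recovered from v = (v - w) + w.\<close>
    have vw: "v = (v - w) + w" "v - w \<in> QT"
      using quasi_trefftz_diff[OF v(1) w(1)] by auto
    have "trace (v - w) = 0"
      using trace_add[of "v - w" w] v(2) w(2) by simp
    moreover have "trace (partial first_coord (v - w)) = 0"
      using partial_add_quasi_trefftz[OF vw(2) w(1), of first_coord] v(3) w(3)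
        trace_add[of "partial first_coord (v - w)" "partial first_coord w"] by simp
    ultimately have "v - w = 0"
      by (rule zero_cauchy_data[OF vw(2)])
    then show ?thesis by simp
  qed
  then show ?thesis using exists_cauchy_data[OF f g] by blast
qed

section \<open>The basis obtained from bases of the data spaces\<close>

theorem qt_basis_is_basis:
  assumes fhat: "is_basis_family {1..poly_dim (CARD('d) - 1) (int p)} fhat
      (poly_space (UNIV - {first_coord}) (int p))"
    and ftilde: "is_basis_family {1..poly_dim (CARD('d) - 1) (int p - 1)} ftilde
      (poly_space (UNIV - {first_coord}) (int p - 1))"
  shows "(\<forall>J\<in>{1..qt_basis_card CARD('d) p}. \<exists>!b. qt_basis_element K \<beta> \<sigma> z p fhat ftilde J b) \<and>
    is_basis (qt_basis K \<beta> \<sigma> z p fhat ftilde) QT"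
proof -
  define S where "S = poly_dim (CARD('d) - 1) (int p)"
  \<comment> \<open>For p = 0 this number is 0 and G = {0}, so the second family is empty.\<close>
  define S' where "S' = poly_dim (CARD('d) - 1) (int p - 1)"
  define F where "F = poly_space (UNIV - {first_coord :: 'd}) (int p)"
  define G where "G = poly_space (UNIV - {first_coord :: 'd}) (int p - 1)"
  \<comment> \<open>Unique solvability for given data makes these descriptions proper and turns the
    defining property of each b_J into an equation.\<close>
  define b where "b = (\<lambda>i. THE v. v \<in> QT \<and> trace v = fhat i \<and> trace (partial first_coord v) = 0)"
  define b' where "b' = (\<lambda>j. THE v. v \<in> QT \<and> trace v = 0 \<and> trace (partial first_coord v) = ftilde j)"
  have fhat': "is_basis_family {1..S} fhat F" and ftilde': "is_basis_family {1..S'} ftilde G"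
    using fhat ftilde by (simp_all add: S_def S'_def F_def G_def)
  have in_FG: "0 \<in> F" "0 \<in> G" "\<And>i. i \<in> {1..S} \<Longrightarrow> fhat i \<in> F" "\<And>j. j \<in> {1..S'} \<Longrightarrow> ftilde j \<in> G"
    using is_basis_family_in_space[OF fhat'] is_basis_family_in_space[OF ftilde']
    by (auto simp: F_def G_def poly_space_def span_zero)
  note unique = unique_cauchy_data[folded F_def G_def]
  have b: "v \<in> QT \<and> trace v = fhat i \<and> trace (partial first_coord v) = 0 \<longleftrightarrow> v = b i"
    if "i \<in> {1..S}" for v i
    using theI'[OF unique[OF in_FG(3)[OF that] in_FG(2)]] unique[OF in_FG(3)[OF that] in_FG(2)]
    unfolding b_def by blast
  have b': "v \<in> QT \<and> trace v = 0 \<and> trace (partial first_coord v) = ftilde j \<longleftrightarrow> v = b' j"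
    if "j \<in> {1..S'}" for v j
    using theI'[OF unique[OF in_FG(1) in_FG(4)[OF that]]] unique[OF in_FG(1) in_FG(4)[OF that]]
    unfolding b'_def by blast
  have card: "qt_basis_card CARD('d) p = S + S'"
    by (simp add: qt_basis_card_def S_def S'_def)
  have element: "qt_basis_element K \<beta> \<sigma> z p fhat ftilde J v \<longleftrightarrow> v = (if J \<le> S then b J else b' (J - S))"
    if "J \<in> {1..S + S'}" for J v
  proof (cases "J \<le> S")
    case True
    then show ?thesis
      using that b[of J v] unfolding qt_basis_element_def Let_def S_def[symmetric] by simp
  next
    case False
    then have "J - S \<in> {1..S'}" using that by auto
    from False b'[OF this, of v] show ?thesis
      unfolding qt_basis_element_def Let_def S_def[symmetric] by simp
  qed
  have "qt_basis K \<beta> \<sigma> z p fhat ftilde = b ` {1..S} \<union> b' ` {1..S'}" (is "?B = ?R")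
  proof
    show "?B \<subseteq> ?R"
    proof
      fix v assume "v \<in> ?B"
      then obtain J where J: "J \<in> {1..S + S'}" "v = (if J \<le> S then b J else b' (J - S))"
        using element unfolding qt_basis_def card by blast
      then show "v \<in> ?R"
        by (cases "J \<le> S") (auto intro!: image_eqI[of _ _ "J - S"])
    qed
    have "b i \<in> ?B" if "i \<in> {1..S}" for i
      using that element[of i] unfolding qt_basis_def card by (auto intro!: bexI[of _ i])
    moreover have "b' j \<in> ?B" if "j \<in> {1..S'}" for j
      using that element[of "S + j"] unfolding qt_basis_def card by (auto intro!: bexI[of _ "S + j"])
    ultimately show "?R \<subseteq> ?B" by blast
  qed
  moreover have "is_basis (b ` {1..S} \<union> b' ` {1..S'}) QT"
  proof (rule is_basis_preimages[of _ _ fhat F ftilde G QT trace "\<lambda>v. trace (partial first_coord v)"])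
    show "trace v \<in> F" "trace (partial first_coord v) \<in> G" if "v \<in> QT" for v
      using that restrict_first_in_poly_space partial_in_poly_space
      unfolding F_def G_def quasi_trefftz_iff by blast+
    show "b i \<in> QT \<and> trace (b i) = fhat i \<and> trace (partial first_coord (b i)) = 0" if "i \<in> {1..S}" for i
      using b[OF that] by blast
    show "b' j \<in> QT \<and> trace (b' j) = 0 \<and> trace (partial first_coord (b' j)) = ftilde j"
      if "j \<in> {1..S'}" for j
      using b'[OF that] by blast
  qed (use fhat' ftilde' in \<open>simp_all add: subspace_quasi_trefftz trace_add trace_scale
      partial_add_quasi_trefftz partial_scale_quasi_trefftz zero_cauchy_data\<close>)
  ultimately show ?thesis
    using element by (auto simp: card)
qed

end

theorem proposition5p4p1:
  fixes T :: "'d::{finite,linorder} point set"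
    and xT :: "'d point"
    and p :: nat
    and K :: "'d matrix_field"
    and \<beta> :: "'d vector_field"
    and \<sigma> :: "'d scalar_field"
    and kmin :: real
    and fhat ftilde :: "nat \<Rightarrow> 'd scalar_field"
  assumes "mesh_element T"
    and "xT \<in> T"
    and "\<And>j m. Ck_on (nat (max (int p - 1) 1)) T (\<lambda>x. K x $ j $ m)"
    and "\<And>j. Ck_on (nat (max (int p - 1) 1)) T (\<lambda>x. \<beta> x $ j)"
    and "Ck_on (nat (max (int p - 2) 0)) T \<sigma>"
    and "kmin > 0"
    and "\<And>x \<xi>. x \<in> T \<Longrightarrow> \<xi> \<bullet> (K x *v \<xi>) \<ge> kmin * (norm \<xi>)\<^sup>2"
    and "is_basis_family {1..poly_dim (CARD('d) - 1) (int p)} fhat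
           (poly_space (UNIV - {first_coord}) (int p))"
    and "is_basis_family {1..poly_dim (CARD('d) - 1) (int p - 1)} ftilde
           (poly_space (UNIV - {first_coord}) (int p - 1))"
  shows "(\<forall>J\<in>{1..qt_basis_card CARD('d) p}. \<exists>!b. qt_basis_element K \<beta> \<sigma> xT p fhat ftilde J b) \<and>
    is_basis (qt_basis K \<beta> \<sigma> xT p fhat ftilde) (quasi_trefftz K \<beta> \<sigma> xT p)"
proof -
  \<comment> \<open>The left-hand sides are truncated at 0, so the bounds hold for p = 0 and p = 1
    too.\<close>
  have le: "p - 1 \<le> nat (max (int p - 1) 1)" "p - 2 \<le> nat (max (int p - 2) 0)"
    by linarith+
  \<comment> \<open>Ellipticity is tested with e_1, whose norm is 1, which gives K_11 \<ge>
    \<open>kmin\<close> at the centre.\<close>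
  let ?e = "axis (first_coord :: 'd) (1 :: real)"
  have "?e \<bullet> (K xT *v ?e) = K xT $ first_coord $ first_coord"
    by (simp add: inner_axis' matrix_vector_mult_basis column_def)
  moreover have "?e \<bullet> (K xT *v ?e) \<ge> kmin"
    using assms(7)[OF assms(2), of ?e] by (simp add: norm_axis_1)
  ultimately have "K xT $ first_coord $ first_coord \<noteq> 0"
    using assms(6) by auto
  then interpret quasi_trefftz_setup T xT p K \<beta> \<sigma>
    using assms(1,2) Ck_on_mono[OF assms(3) le(1)] Ck_on_mono[OF assms(4) le(1)]
      Ck_on_mono[OF assms(5) le(2)]
    by unfold_locales (auto simp: mesh_element_def)
  show ?thesis
    using assms(8,9) by (rule qt_basis_is_basis)
qed

end
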